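(* Let $F:\mathbb{C}\to\mathbb{R}$ be a $\mathcal{C}^\infty$-smooth subharmonic function that vanishes to infinite order at $0\in\mathbb{C}$ and satisfies the following condition: $F$ is radial, i.e. $F(z)=F(|z|)$ for all $z\in\mathbb{C}$, and there exists $\eta>0$ such that, for some $R>0$ and $C>0$, $F(z)\geq C|z|^\eta$ whenever $|z|\geq R$. Let $\Omega_F:=\{(z,w)\in\mathbb{C}^2:\operatorname{Im} w>F(z)\}$, and suppose that the boundary $\partial\Omega_F$ is not Levi-flat around the origin. 1) Define $f:[0,\infty)\to\mathbb{R}$ by the relation $f(|z|)=F(z)$. Then $f$ is a strictly increasing function on $[0,\infty)$. 2) Assume that $F$ satisfies the following condition, where $\Lambda_f(x):=-1/\log(f(x))$ for $0<x<f^{-1}(1)$ and $\Lambda_f(0):=0$: there exist constants $B>0$ and $\varepsilon_0>0$ (with $\varepsilon_0<f^{-1}(1)$) and a continuous function $\chi:[0,\varepsilon_0]\to\mathbb{R}$ such that $\chi^p$ is convex on $(0,\varepsilon_0)$ for some $p>0$, and $$\frac{1}{B}\,\chi(x)\ \leq\ \Lambda_f(x)\ \leq\ B\,\chi(x)\qquad\forall x\in[0,\varepsilon_0].$$ Then there exist constants $C_0,C_1>0$, independent of $\alpha$ and $N$ below, such that for each $\alpha>0$ and each positive integer $N$ there exists a constant $H_{N,\alpha}>0$, depending only on $\alpha$ and $N$ (for the given $F$), with $$C_0(\operatorname{Im} w)^{-2}\left[f^{-1}(\operatorname{Im} w)\right]^{-2}\ \leq\ K_F(z,w)\ \leq\ C_1(\operatorname{Im}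 w)^{-2}\left[f^{-1}(\operatorname{Im} w)\right]^{-2}$$ for all $(z,w)\in\mathscr{A}_{\alpha,N}$ with $0<\operatorname{Im} w<H_{N,\alpha}$, where $\mathscr{A}_{\alpha,N}$ denotes the approach region $$\mathscr{A}_{\alpha,N}:=\left\{(z,w)\in\Omega_F:\sqrt{|z|^2+|\operatorname{Re} w|^2}<\alpha(\operatorname{Im} w)^{1/N}\right\}.$$ 3) Under the assumptions of part 2), there exists a constant $H_0>0$, independent of $\alpha$ and $N$, such that the left-hand inequality $$C_0(\operatorname{Im} w)^{-2}\left[f^{-1}(\operatorname{Im} w)\right]^{-2}\ \leq\ K_F(z,w)$$ (with the same constant $C_0$) in fact holds for all $(z,w)\in\Omega_F\cap\{(z,w):\operatorname{Im} w<H_0\}$.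
   Context: For a domain $\Omega\subset\mathbb{C}^2$, the Bergman projection is the orthogonal projection $B_\Omega:\mathbb{L}^2(\Omega)\to\mathcal{O}(\Omega)\cap\mathbb{L}^2(\Omega)$ (with respect to Lebesgue measure), where $\mathcal{O}(\Omega)$ is the space of holomorphic functions on $\Omega$; the Bergman kernel of $\Omega$ is the integral kernel representing this projection. $K_F(z,w)$ denotes the Bergman kernel of $\Omega_F$ restricted to the diagonal, i.e. evaluated at $((z,w),(z,w))$. "Vanishes to infinite order at $0$" means that $F$ and all of its partial derivatives vanish at $0$. "$\partial\Omega_F$ is not Levi-flat around the origin" means that there is no neighbourhood $U$ of $(0,0)$ in $\mathbb{C}^2$ such that the Levi form of $\partial\Omega_F$ vanishes identically on $\partial\Omega_F\cap U$. In parts 2) and 3), $f^{-1}$ is the inverse of the strictly increasing function $f$ of part 1); since $f$ is continuous, $f(0)=0$ and $f$ is unbounded, $f^{-1}$ is defined on $[0,\infty)$. *)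

theory Defs
  imports "HOL-Analysis.Analysis"
begin

section \<open>Smooth functions on a Euclidean space\<close>

definition dir_deriv :: "'a::real_normed_vector \<Rightarrow> ('a \<Rightarrow> 'b::real_normed_vector) \<Rightarrow> 'a \<Rightarrow> 'b" where
  "dir_deriv v g x = frechet_derivative g (at x) v"

primrec cont_diff :: "nat \<Rightarrow> ('a::euclidean_space \<Rightarrow> 'b::real_normed_vector) \<Rightarrow> bool" where
  "cont_diff 0 g \<longleftrightarrow> continuous_on UNIV g"
| "cont_diff (Suc k) g \<longleftrightarrow>
     g differentiable_on UNIV \<and> (\<forall>b\<in>Basis. cont_diff k (dir_deriv b g))"

definition smooth :: "('a::euclidean_space \<Rightarrow> 'b::real_normed_vector) \<Rightarrow> bool" where
  "smooth g \<longleftrightarrow> (\<forall>k. cont_diff k g)"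

text \<open>The empty list of directions gives the value of the function itself.\<close>

definition vanishes_to_infinite_order ::
    "('a::euclidean_space \<Rightarrow> 'b::real_normed_vector) \<Rightarrow> 'a \<Rightarrow> bool" where
  "vanishes_to_infinite_order g a \<longleftrightarrow>
     (\<forall>bs. set bs \<subseteq> Basis \<longrightarrow> foldr dir_deriv bs g a = 0)"


section \<open>Subharmonic functions on the plane\<close>

text \<open>
  Upper semicontinuity and the sub-mean value inequality on all circles. Since the functions
  considered do not take the value minus infinity, their circular means are finite; the
  integrability clause says so, as \<^const>\<open>integral\<close> is 0 on non-integrable functions.
\<close>

definition subharmonic :: "(complex \<Rightarrow> real) \<Rightarrow> bool" where
  "subharmonic u \<longleftrightarrow>
     (\<forall>c. open {z. u z < c}) \<and>
     (\<forall>z. \<forall>r>0.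
        (\<lambda>t. u (z + of_real r * cis t)) absolutely_integrable_on {0..2*pi} \<and>
        u z \<le> 1 / (2*pi) * integral {0..2*pi} (\<lambda>t. u (z + of_real r * cis t)))"


section \<open>The Levi form of a hypersurface in two-dimensional complex space\<close>

type_synonym complex2 = "complex \<times> complex"

text \<open>
  \<open>wirtinger e\<close> and \<open>wirtinger_bar e\<close> are the operators d/dz and d/d(conj z) for the complex
  coordinate z along the standard unit vector \<open>e\<close>.
\<close>

definition wirtinger :: "complex2 \<Rightarrow> (complex2 \<Rightarrow> complex) \<Rightarrow> complex2 \<Rightarrow> complex" where
  "wirtinger e g p =
     (dir_deriv e g p - \<i> * dir_deriv (\<i> * fst e, \<i> * snd e) g p) / 2"

definition wirtinger_bar :: "complex2 \<Rightarrow> (complex2 \<Rightarrow> complex) \<Rightarrow> complex2 \<Rightarrow> complex" where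
  "wirtinger_bar e g p =
     (dir_deriv e g p + \<i> * dir_deriv (\<i> * fst e, \<i> * snd e) g p) / 2"

definition complex_tangent :: "(complex2 \<Rightarrow> real) \<Rightarrow> complex2 \<Rightarrow> complex2 set" where
  "complex_tangent \<rho> p =
     {t. wirtinger (1, 0) (\<lambda>q. of_real (\<rho> q)) p * fst t
         + wirtinger (0, 1) (\<lambda>q. of_real (\<rho> q)) p * snd t = 0}"

definition levi_form :: "(complex2 \<Rightarrow> real) \<Rightarrow> complex2 \<Rightarrow> complex2 \<Rightarrow> complex" where
  "levi_form \<rho> p t =
     (let h = (\<lambda>d e. wirtinger d (wirtinger_bar e (\<lambda>q. of_real (\<rho> q))) p) in
        h (1, 0) (1, 0) * fst t * cnj (fst t) + h (1, 0) (0, 1) * fst t * cnj (snd t)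
      + h (0, 1) (1, 0) * snd t * cnj (fst t) + h (0, 1) (0, 1) * snd t * cnj (snd t))"

text \<open>
  \<open>\<rho>\<close> is meant to be a smooth defining function of the domain \<open>\<Omega>\<close>, negative exactly on \<open>\<Omega>\<close> and
  with nonvanishing differential on the boundary. Another choice of \<open>\<rho>\<close> multiplies the Levi form
  on complex tangent vectors by a positive function, so the notion does not depend on it.
\<close>

definition levi_flat_around :: "complex2 set \<Rightarrow> (complex2 \<Rightarrow> real) \<Rightarrow> complex2 \<Rightarrow> bool" where
  "levi_flat_around \<Omega> \<rho> p \<longleftrightarrow>
     (\<exists>U. open U \<and> p \<in> U \<and>
          (\<forall>q \<in> frontier \<Omega> \<inter> U. \<forall>t \<in> complex_tangent \<rho> q. levi_form \<rho> q t = 0))"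


section \<open>The Bergman projection and the Bergman kernel\<close>

definition holomorphic2_on :: "(complex2 \<Rightarrow> complex) \<Rightarrow> complex2 set \<Rightarrow> bool" where
  "holomorphic2_on g \<Omega> \<longleftrightarrow>
     (\<forall>p\<in>\<Omega>. \<exists>a b. (g has_derivative (\<lambda>h. a * fst h + b * snd h)) (at p))"

definition L2_on :: "complex2 set \<Rightarrow> (complex2 \<Rightarrow> complex) set" where
  "L2_on \<Omega> = {g. g \<in> borel_measurable (lebesgue_on \<Omega>) \<and>
                  integrable (lebesgue_on \<Omega>) (\<lambda>p. (cmod (g p))\<^sup>2)}"

text \<open>
  Functions on \<open>\<Omega>\<close> are represented by total functions; elements of the Bergman space are
  normalised to be 0 off \<open>\<Omega>\<close>, which makes the descriptions below unique.
\<close>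

definition bergman_space :: "complex2 set \<Rightarrow> (complex2 \<Rightarrow> complex) set" where
  "bergman_space \<Omega> = {g \<in> L2_on \<Omega>. holomorphic2_on g \<Omega> \<and> (\<forall>p. p \<notin> \<Omega> \<longrightarrow> g p = 0)}"

definition bergman_projection ::
    "complex2 set \<Rightarrow> (complex2 \<Rightarrow> complex) \<Rightarrow> complex2 \<Rightarrow> complex" where
  "bergman_projection \<Omega> g =
     (THE u. u \<in> bergman_space \<Omega> \<and>
             (\<forall>h\<in>bergman_space \<Omega>. (LINT p|lebesgue_on \<Omega>. (g p - u p) * cnj (h p)) = 0))"

text \<open>
  The integral representation determines \<open>K p\<close> only almost everywhere; that its conjugate lies in
  the Bergman space fixes the values, in particular those on the diagonal.
\<close>

definition bergman_kernel :: "complex2 set \<Rightarrow> complex2 \<Rightarrow> complex2 \<Rightarrow> complex" where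
  "bergman_kernel \<Omega> =
     (THE K. (\<forall>p. p \<notin> \<Omega> \<longrightarrow> K p = (\<lambda>q. 0)) \<and>
             (\<forall>p\<in>\<Omega>. (\<lambda>q. cnj (K p q)) \<in> bergman_space \<Omega>) \<and>
             (\<forall>g\<in>L2_on \<Omega>. \<forall>p\<in>\<Omega>.
                bergman_projection \<Omega> g p = (LINT q|lebesgue_on \<Omega>. K p q * g q)))"


section \<open>The domain above the graph of a function\<close>

definition graph_domain :: "(complex \<Rightarrow> real) \<Rightarrow> complex2 set" where
  "graph_domain F = {(z, w). Im w > F z}"

definition graph_defining :: "(complex \<Rightarrow> real) \<Rightarrow> complex2 \<Rightarrow> real" where
  "graph_defining F = (\<lambda>(z, w). F z - Im w)"

text \<open>The Bergman kernel is real (and nonnegative) on the diagonal.\<close>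

definition diag_kernel :: "(complex \<Rightarrow> real) \<Rightarrow> complex \<Rightarrow> complex \<Rightarrow> real" where
  "diag_kernel F z w = Re (bergman_kernel (graph_domain F) (z, w) (z, w))"

definition approach_region :: "(complex \<Rightarrow> real) \<Rightarrow> real \<Rightarrow> nat \<Rightarrow> complex2 set" where
  "approach_region F \<alpha> N =
     {(z, w) \<in> graph_domain F.
        sqrt ((cmod z)\<^sup>2 + \<bar>Re w\<bar>\<^sup>2) < \<alpha> * Im w powr (1 / real N)}"

text \<open>Profiles are functions on the half-line; their values at negative arguments are irrelevant.\<close>

definition profile_inv :: "(real \<Rightarrow> real) \<Rightarrow> real \<Rightarrow> real" where
  "profile_inv f = inv_into {0..} f"

definition Lambda :: "(real \<Rightarrow> real) \<Rightarrow> real \<Rightarrow> real" where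
  "Lambda f x = (if x = 0 then 0 else - 1 / ln (f x))"

definition Lambda_condition :: "(real \<Rightarrow> real) \<Rightarrow> bool" where
  "Lambda_condition f \<longleftrightarrow>
     (\<exists>B>0. \<exists>\<epsilon>\<^sub>0>0. \<exists>\<phi>. \<epsilon>\<^sub>0 < profile_inv f 1 \<and>
        continuous_on {0..\<epsilon>\<^sub>0} \<phi> \<and>
        (\<exists>p>0. convex_on {0<..<\<epsilon>\<^sub>0} (\<lambda>x. \<phi> x powr p)) \<and>
        (\<forall>x\<in>{0..\<epsilon>\<^sub>0}. 1 / B * \<phi> x \<le> Lambda f x \<and> Lambda f x \<le> B * \<phi> x))"

end

theory Submission
  imports Defs "HOL-Complex_Analysis.Complex_Analysis"
begin

text \<open>
  Write \<open>\<Omega>\<close> for the domain above the graph of \<open>F\<close>, \<open>t = Im w\<close> and \<open>s = f\<^sup>-\<^sup>1(t)\<close>.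

  That \<open>f\<close> increases strictly is the maximum principle: otherwise the radial subharmonic function \<open>F\<close>
  would be constant, hence 0, near the origin, and there the boundary of \<open>\<Omega>\<close> would be the Levi-flat
  hyperplane \<open>Im w = 0\<close> (\<open>radial_subharmonic_strict_mono\<close>, \<open>levi_flat_around_of_locally_zero\<close>).

  On the diagonal the Bergman kernel is the supremum of \<open>|h p|\<^sup>2 / |h|\<^sup>2\<close> over the Bergman space, so
  the two-sided estimate says that, as seen from a point at height \<open>t\<close>, the domain looks like a bidisc of
  radii comparable to \<open>s\<close> in \<open>z\<close> and to \<open>t\<close> in \<open>w\<close>. The condition on \<open>\<Lambda>\<close> enters through one consequence,
  \<open>f x \<le> (f (l x))\<^sup>2\<close> for a constant \<open>l > 1\<close> and small \<open>x\<close> (\<open>Lambda_condition_square_growth\<close>): around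
  \<open>s\<close> the profile passes from \<open>t\<^sup>2\<close>, far below \<open>t\<close>, to \<open>sqrt t\<close>, far above \<open>t\<close>, while its argument changes by the
  bounded factor \<open>l\<^sup>2\<close>.

  For the upper bound, \<open>F \<le> t\<^sup>2 < t / 2\<close> on the disc of radius \<open>s / l\<close>. The function \<open>f\<close> is flat to infinite
  order, so \<open>s\<close> exceeds every multiple of every power \<open>t\<^sup>1\<^sup>/\<^sup>N\<close> when \<open>t\<close> is small, and the approach region
  keeps \<open>z\<close> inside the concentric disc of half that radius. Hence a bidisc of radii \<open>s / (2 l)\<close> and \<open>t / 2\<close> around the
  point lies in \<open>\<Omega>\<close>, and the mean value inequality applies (\<open>diag_kernel_upper_of_polydisc\<close>).

  For the lower bound the test function \<open>(w - Re w0 + \<i> t)\<^sup>-\<^sup>k\<close> serves at every point of \<open>\<Omega>\<close> of height \<open>t\<close>.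
  Integrating out \<open>w\<close> leaves the integral of \<open>(t + F)\<^sup>-\<^sup>q\<close> with \<open>q = 2 k - 2\<close>. The disc of radius
  \<open>l s\<close> contributes a multiple of \<open>t\<^sup>-\<^sup>q s\<^sup>2\<close>. Outside it \<open>F \<ge> sqrt t\<close>, and the growth of \<open>F\<close> at infinity
  makes the remaining contribution at most a multiple of \<open>t\<^sup>1\<^sup>-\<^sup>q\<close>, which is no larger up to a constant, since
  \<open>t = f s\<close> is at most a multiple of \<open>s\<^sup>2\<close> (\<open>diag_kernel_lower_of_weight\<close>, \<open>radial_weight_integral\<close>).

  The extremal description of the kernel needs the Bergman space to be a Hilbert space of
  functions on which point evaluations are bounded. Boundedness and completeness both come from the mean
  value inequality on bidiscs, and the Riesz representation of functionals then gives existence and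
  uniqueness of projection and kernel.
\<close>

section \<open>Square-integrable functions and the Riesz representation\<close>

definition sq_integrable :: "'a measure \<Rightarrow> ('a \<Rightarrow> complex) set" where
  "sq_integrable M = {g \<in> borel_measurable M. integrable M (\<lambda>p. (cmod (g p))\<^sup>2)}"

definition l2_inner :: "'a measure \<Rightarrow> ('a \<Rightarrow> complex) \<Rightarrow> ('a \<Rightarrow> complex) \<Rightarrow> complex" where
  "l2_inner M g h = (LINT p|M. g p * cnj (h p))"

definition l2_normsq :: "'a measure \<Rightarrow> ('a \<Rightarrow> complex) \<Rightarrow> real" where
  "l2_normsq M g = (LINT p|M. (cmod (g p))\<^sup>2)"

lemma sq_integrableD:
  assumes "g \<in> sq_integrable M"
  shows "g \<in> borel_measurable M" "integrable M (\<lambda>p. (cmod (g p))\<^sup>2)"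
  using assms by (auto simp: sq_integrable_def)

lemma integrable_mult_cnj:
  assumes "g \<in> sq_integrable M" "h \<in> sq_integrable M"
  shows "integrable M (\<lambda>p. g p * cnj (h p))"
proof (rule Bochner_Integration.integrable_bound)
  show "integrable M (\<lambda>p. (cmod (g p))\<^sup>2 + (cmod (h p))\<^sup>2)"
    using assms by (auto simp: sq_integrable_def)
  have [measurable]: "g \<in> borel_measurable M" "h \<in> borel_measurable M"
    using assms by (auto simp: sq_integrable_def)
  have "(\<lambda>p. cnj (h p)) \<in> borel_measurable M"
    by (rule borel_measurable_continuous_on[where f = cnj]) (auto intro: continuous_intros)
  then show "(\<lambda>p. g p * cnj (h p)) \<in> borel_measurable M" by measurable
  have "cmod (g p * cnj (h p)) \<le> (cmod (g p))\<^sup>2 + (cmod (h p))\<^sup>2" for p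
    using sum_squares_bound[of "cmod (g p)" "cmod (h p)"]
      mult_nonneg_nonneg[OF norm_ge_zero[of "g p"] norm_ge_zero[of "h p"]]
    unfolding norm_mult complex_mod_cnj by linarith
  then show "AE p in M. cmod (g p * cnj (h p)) \<le> norm ((cmod (g p))\<^sup>2 + (cmod (h p))\<^sup>2)"
    by (intro AE_I2) simp
qed

lemma sq_integrable_scale:
  assumes "g \<in> sq_integrable M"
  shows "(\<lambda>p. c * g p) \<in> sq_integrable M"
  using assms by (auto simp: sq_integrable_def norm_mult power_mult_distrib)

lemma cmod_add_sq: "(cmod (x + y))\<^sup>2 = (cmod x)\<^sup>2 + 2 * Re (x * cnj y) + (cmod y)\<^sup>2"
  unfolding cmod_power2 by (simp add: algebra_simps power2_eq_square)

lemma sq_integrable_add: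
  assumes "g \<in> sq_integrable M" "h \<in> sq_integrable M"
  shows "(\<lambda>p. g p + h p) \<in> sq_integrable M"
proof -
  have "integrable M (\<lambda>p. (cmod (g p))\<^sup>2 + 2 * Re (g p * cnj (h p)) + (cmod (h p))\<^sup>2)"
    using assms integrable_Re[OF integrable_mult_cnj[OF assms]]
    by (intro Bochner_Integration.integrable_add integrable_mult_right) (auto simp: sq_integrable_def)
  then show ?thesis
    using assms unfolding sq_integrable_def cmod_add_sq[symmetric] by (simp add: borel_measurable_add)
qed

lemma sq_integrable_diff:
  assumes "g \<in> sq_integrable M" "h \<in> sq_integrable M"
  shows "(\<lambda>p. g p - h p) \<in> sq_integrable M"
  using sq_integrable_add[OF assms(1) sq_integrable_scale[OF assms(2), of "-1"]] by simp

lemma l2_normsq_nonneg [simp]: "0 \<le> l2_normsq M g"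
  by (simp add: l2_normsq_def)

lemma l2_inner_self: "l2_inner M g g = of_real (l2_normsq M g)"
  by (simp add: l2_inner_def l2_normsq_def complex_norm_square[symmetric] flip: integral_complex_of_real)

lemma l2_inner_swap: "l2_inner M h g = cnj (l2_inner M g h)"
proof -
  have "cnj (l2_inner M g h) = (LINT p|M. cnj (g p * cnj (h p)))"
    unfolding l2_inner_def by (rule Bochner_Integration.integral_cnj[symmetric])
  then show ?thesis by (simp add: l2_inner_def mult.commute)
qed

lemma l2_inner_add_left:
  assumes "g \<in> sq_integrable M" "g' \<in> sq_integrable M" "h \<in> sq_integrable M"
  shows "l2_inner M (\<lambda>p. g p + g' p) h = l2_inner M g h + l2_inner M g' h"
  using integrable_mult_cnj[OF assms(1,3)] integrable_mult_cnj[OF assms(2,3)]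
  by (simp add: l2_inner_def distrib_right)

lemma l2_inner_scale_left: "l2_inner M (\<lambda>p. c * g p) h = c * l2_inner M g h"
  by (simp add: l2_inner_def mult.assoc)

lemma l2_inner_diff_left:
  assumes "g \<in> sq_integrable M" "g' \<in> sq_integrable M" "h \<in> sq_integrable M"
  shows "l2_inner M (\<lambda>p. g p - g' p) h = l2_inner M g h - l2_inner M g' h"
  using integrable_mult_cnj[OF assms(1,3)] integrable_mult_cnj[OF assms(2,3)]
  by (simp add: l2_inner_def left_diff_distrib)

lemma l2_inner_diff_right:
  assumes "g \<in> sq_integrable M" "g' \<in> sq_integrable M" "h \<in> sq_integrable M"
  shows "l2_inner M h (\<lambda>p. g p - g' p) = l2_inner M h g - l2_inner M h g'"
proof -
  have "l2_inner M h (\<lambda>p. g p - g' p) = cnj (l2_inner M (\<lambda>p. g p - g' p) h)" by (rule l2_inner_swap)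
  also have "\<dots> = cnj (l2_inner M g h) - cnj (l2_inner M g' h)" by (simp add: l2_inner_diff_left[OF assms])
  finally show ?thesis by (simp only: l2_inner_swap[symmetric])
qed

lemma l2_normsq_scale: "l2_normsq M (\<lambda>p. c * g p) = (cmod c)\<^sup>2 * l2_normsq M g"
  by (simp add: l2_normsq_def norm_mult power_mult_distrib)

lemma l2_normsq_add:
  assumes "g \<in> sq_integrable M" "h \<in> sq_integrable M"
  shows "l2_normsq M (\<lambda>p. g p + h p) = l2_normsq M g + 2 * Re (l2_inner M g h) + l2_normsq M h"
proof -
  note int = integrable_mult_cnj[OF assms]
  have "l2_normsq M (\<lambda>p. g p + h p)
      = (LINT p|M. (cmod (g p))\<^sup>2 + 2 * Re (g p * cnj (h p)) + (cmod (h p))\<^sup>2)"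
    unfolding l2_normsq_def cmod_add_sq ..
  also have "\<dots> = l2_normsq M g + 2 * (LINT p|M. Re (g p * cnj (h p))) + l2_normsq M h"
    using sq_integrableD(2)[OF assms(1)] sq_integrableD(2)[OF assms(2)] integrable_Re[OF int]
    unfolding l2_normsq_def by (simp del: times_complex.sel)
  also have "(LINT p|M. Re (g p * cnj (h p))) = Re (l2_inner M g h)"
    unfolding l2_inner_def using int by (rule integral_Re)
  finally show ?thesis .
qed

lemma l2_normsq_add_scale:
  assumes "g \<in> sq_integrable M" "h \<in> sq_integrable M"
  shows "l2_normsq M (\<lambda>p. g p + c * h p) = l2_normsq M g + 2 * Re (cnj c * l2_inner M g h) + (cmod c)\<^sup>2 * l2_normsq M h"
proof -
  have "l2_inner M g (\<lambda>p. c * h p) = cnj c * l2_inner M g h"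
    unfolding l2_inner_swap[of M g "\<lambda>p. c * h p"] l2_inner_swap[of M g h] by (simp add: l2_inner_scale_left)
  then show ?thesis
    using l2_normsq_add[OF assms(1) sq_integrable_scale[OF assms(2)], of c] by (simp add: l2_normsq_scale)
qed

lemma parallelogram_law:
  assumes "g \<in> sq_integrable M" "h \<in> sq_integrable M"
  shows "l2_normsq M (\<lambda>p. g p - h p) + l2_normsq M (\<lambda>p. g p + h p) = 2 * l2_normsq M g + 2 * l2_normsq M h"
  using l2_normsq_add_scale[OF assms, of "-1"] l2_normsq_add[OF assms] by simp

lemma Cauchy_Schwarz_l2_inner:
  assumes "g \<in> sq_integrable M" "h \<in> sq_integrable M"
  shows "(cmod (l2_inner M g h))\<^sup>2 \<le> l2_normsq M g * l2_normsq M h"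
proof -
  let ?a = "(cmod (l2_inner M g h))\<^sup>2"
  have *: "0 \<le> l2_normsq M g - 2 * c * ?a + c\<^sup>2 * ?a * l2_normsq M h" for c :: real
  proof -
    have "cnj (l2_inner M g h) * l2_inner M g h = of_real ?a"
      by (simp only: complex_norm_square mult.commute)
    then have "Re (cnj (- of_real c * l2_inner M g h) * l2_inner M g h) = - c * ?a"
      by (simp add: mult.assoc)
    moreover have "(cmod (- of_real c * l2_inner M g h))\<^sup>2 = c\<^sup>2 * ?a"
      by (simp add: norm_mult power_mult_distrib)
    ultimately show ?thesis
      using l2_normsq_add_scale[OF assms, of "- of_real c * l2_inner M g h"]
        l2_normsq_nonneg[of M "\<lambda>p. g p + (- of_real c * l2_inner M g h) * h p"] by simp
  qed
  \<comment> \<open>choose the optimal \<open>c\<close>, or an arbitrarily large one when \<open>h\<close> has norm 0\<close>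
  show ?thesis
  proof (cases "l2_normsq M h = 0")
    case True
    have "?a = 0"
    proof (rule ccontr)
      assume "?a \<noteq> 0"
      then have "?a > 0" by simp
      then show False
        using *[of "(l2_normsq M g + 1) / ?a"] True l2_normsq_nonneg[of M g] by simp
    qed
    then show ?thesis using True by simp
  next
    case False
    then have "l2_normsq M h > 0" using l2_normsq_nonneg[of M h] by linarith
    then show ?thesis
      using *[of "1 / l2_normsq M h"] by (simp add: field_simps power2_eq_square)
  qed
qed

text \<open>
  The elements of the space are honest functions, not classes modulo null sets: for the Bergman
  space this loses nothing, since a holomorphic function that vanishes almost everywhere is 0,
  and it keeps point evaluation meaningful.
\<close>

locale complete_function_space =
  fixes M :: "'a measure" and V :: "('a \<Rightarrow> complex) set"
  assumes sub: "V \<subseteq> sq_integrable M"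
    and add: "\<And>g h. g \<in> V \<Longrightarrow> h \<in> V \<Longrightarrow> (\<lambda>p. g p + h p) \<in> V"
    and scale: "\<And>c g. g \<in> V \<Longrightarrow> (\<lambda>p. c * g p) \<in> V"
    and nonempty: "(\<lambda>p. 0) \<in> V"
    and complete: "\<And>u. \<lbrakk>\<And>n. u n \<in> V;
        \<And>e. e > 0 \<Longrightarrow> \<exists>N. \<forall>m\<ge>N. \<forall>n\<ge>N. l2_normsq M (\<lambda>p. u m p - u n p) < e\<rbrakk>
        \<Longrightarrow> \<exists>l\<in>V. (\<lambda>n. l2_normsq M (\<lambda>p. u n p - l p)) \<longlonglongrightarrow> 0"
begin

lemma sqV: "g \<in> V \<Longrightarrow> g \<in> sq_integrable M"
  using sub by blast

text \<open>
  The representing element is the minimiser of the strictly convex functional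
  \<open>J u = |u|\<^sup>2 - 2 Re (\<phi> u)\<close>. By the parallelogram law a minimising sequence is Cauchy, and the
  first variation of \<open>J\<close> at its limit says that the real parts of \<open>\<phi> h\<close> and of the inner product
  agree; replacing \<open>h\<close> by \<open>\<i> h\<close> gives the imaginary parts.
\<close>

lemma riesz:
  fixes \<phi> :: "('a \<Rightarrow> complex) \<Rightarrow> complex"
  assumes phi_add: "\<And>g h. g \<in> V \<Longrightarrow> h \<in> V \<Longrightarrow> \<phi> (\<lambda>p. g p + h p) = \<phi> g + \<phi> h"
    and phi_scale: "\<And>c g. g \<in> V \<Longrightarrow> \<phi> (\<lambda>p. c * g p) = c * \<phi> g"
    and bound: "\<And>g. g \<in> V \<Longrightarrow> (cmod (\<phi> g))\<^sup>2 \<le> C * l2_normsq M g"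
    and "C \<ge> 0"
  shows "\<exists>u\<in>V. \<forall>h\<in>V. \<phi> h = l2_inner M h u"
proof -
  define J where "J u = l2_normsq M u - 2 * Re (\<phi> u)" for u
  have J_lower: "J u \<ge> - C" if "u \<in> V" for u
  proof -
    have "(Re (\<phi> u))\<^sup>2 \<le> C * l2_normsq M u"
      using bound[OF that] power_mono[OF abs_Re_le_cmod[of "\<phi> u"], of 2] by simp
    moreover have "0 \<le> (l2_normsq M u - C)\<^sup>2" by simp
    then have "4 * (C * l2_normsq M u) \<le> (l2_normsq M u + C)\<^sup>2"
      by (simp add: power2_eq_square algebra_simps)
    ultimately have "(2 * Re (\<phi> u))\<^sup>2 \<le> (l2_normsq M u + C)\<^sup>2"
      by (simp add: power_mult_distrib)
    then have "2 * Re (\<phi> u) \<le> l2_normsq M u + C"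
      by (rule power2_le_imp_le) (simp add: \<open>C \<ge> 0\<close>)
    then show ?thesis by (simp add: J_def)
  qed
  define d where "d = Inf (J ` V)"
  have bdd: "bdd_below (J ` V)" using J_lower by (meson bdd_belowI2)
  have d_le: "d \<le> J v" if "v \<in> V" for v
    unfolding d_def using bdd that by (intro cInf_lower) auto
  have "\<forall>n. \<exists>u. u \<in> V \<and> J u < d + 1 / (real n + 1)"
  proof
    fix n
    have "J ` V \<noteq> {}" using nonempty by blast
    moreover have "Inf (J ` V) < d + 1 / (real n + 1)" by (simp add: d_def)
    ultimately have "\<exists>x\<in>J ` V. x < d + 1 / (real n + 1)" by (rule cInf_lessD)
    then show "\<exists>u. u \<in> V \<and> J u < d + 1 / (real n + 1)" by auto
  qed
  from choice[OF this] obtain u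
    where u: "\<And>n. u n \<in> V" "\<And>n. J (u n) < d + 1 / (real n + 1)" by auto
  have close: "l2_normsq M (\<lambda>p. u m p - u n p) \<le> 2 * (1 / (real m + 1)) + 2 * (1 / (real n + 1))" for m n
  proof -
    define v where "v = (\<lambda>p. (1/2) * (u m p + u n p))"
    have vV: "v \<in> V" unfolding v_def by (intro scale add u(1))
    have nv: "l2_normsq M v = l2_normsq M (\<lambda>p. u m p + u n p) / 4"
      unfolding v_def l2_normsq_scale by (simp add: power2_eq_square)
    have "\<phi> v = (1/2) * (\<phi> (u m) + \<phi> (u n))"
      unfolding v_def by (simp only: phi_scale[OF add[OF u(1) u(1)]] phi_add[OF u(1) u(1)])
    then have "Re (\<phi> v) = Re ((1/2) * (\<phi> (u m) + \<phi> (u n)))" by (rule arg_cong)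
    then have pv: "Re (\<phi> v) = (Re (\<phi> (u m)) + Re (\<phi> (u n))) / 2" by simp
    have Jv: "4 * J v = l2_normsq M (\<lambda>p. u m p + u n p) - 4 * Re (\<phi> (u m)) - 4 * Re (\<phi> (u n))"
      unfolding J_def nv pv by (simp add: field_simps)
    have Ju: "l2_normsq M (u k) = J (u k) + 2 * Re (\<phi> (u k))" for k by (simp add: J_def)
    show ?thesis
      using d_le[OF vV] u(2)[of m] u(2)[of n] Jv
        parallelogram_law[OF sqV[OF u(1)[of m]] sqV[OF u(1)[of n]]]
      unfolding Ju by argo
  qed
  have "\<exists>l\<in>V. (\<lambda>n. l2_normsq M (\<lambda>p. u n p - l p)) \<longlonglongrightarrow> 0"
  proof (rule complete[OF u(1)])
    fix e :: real assume "e > 0"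
    obtain N :: nat where N: "4 / e < real N" using reals_Archimedean2 by blast
    show "\<exists>N. \<forall>m\<ge>N. \<forall>n\<ge>N. l2_normsq M (\<lambda>p. u m p - u n p) < e"
    proof (intro exI allI impI)
      fix m n assume "m \<ge> N" "n \<ge> N"
      have *: "1 / (real k + 1) < e / 4" if "k \<ge> N" for k
      proof -
        have "4 / e < real k + 1" using N that by linarith
        then show ?thesis using \<open>e > 0\<close> by (simp add: field_simps)
      qed
      show "l2_normsq M (\<lambda>p. u m p - u n p) < e"
        using close[of m n] *[OF \<open>m \<ge> N\<close>] *[OF \<open>n \<ge> N\<close>] by linarith
    qed
  qed
  then obtain l where l: "l \<in> V" "(\<lambda>n. l2_normsq M (\<lambda>p. u n p - l p)) \<longlonglongrightarrow> 0" by blast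
  have Re_eq: "Re (\<phi> h) = Re (l2_inner M l h)" if h: "h \<in> V" for h
  proof -
    have "(\<lambda>n. sqrt (l2_normsq M (\<lambda>p. u n p - l p) * l2_normsq M h)) \<longlonglongrightarrow> sqrt (0 * l2_normsq M h)"
      by (intro tendsto_intros l)
    then have lim0: "(\<lambda>n. sqrt (l2_normsq M (\<lambda>p. u n p - l p) * l2_normsq M h)) \<longlonglongrightarrow> 0" by simp
    have "cmod (l2_inner M (u n) h - l2_inner M l h) \<le> sqrt (l2_normsq M (\<lambda>p. u n p - l p) * l2_normsq M h)" for n
    proof -
      have "(cmod (l2_inner M (\<lambda>p. u n p - l p) h))\<^sup>2 \<le> l2_normsq M (\<lambda>p. u n p - l p) * l2_normsq M h"
        by (intro Cauchy_Schwarz_l2_inner sq_integrable_diff sqV u(1) l(1) h)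
      then show ?thesis
        unfolding l2_inner_diff_left[OF sqV[OF u(1)] sqV[OF l(1)] sqV[OF h]] by (rule real_le_rsqrt)
    qed
    then have "(\<lambda>n. l2_inner M (u n) h - l2_inner M l h) \<longlonglongrightarrow> 0"
      by (intro Lim_null_comparison[OF _ lim0] always_eventually) auto
    then have lim: "(\<lambda>n. l2_inner M (u n) h) \<longlonglongrightarrow> l2_inner M l h"
      by (simp add: LIM_zero_iff)
    \<comment> \<open>comparing \<open>J (u n + c h)\<close> with the infimum and letting \<open>n\<close> tend to infinity\<close>
    have ineq: "0 \<le> 2 * c * (Re (l2_inner M l h) - Re (\<phi> h)) + c\<^sup>2 * l2_normsq M h" for c :: real
    proof -
      have "- (1 / (real n + 1)) \<le> 2 * c * (Re (l2_inner M (u n) h) - Re (\<phi> h)) + c\<^sup>2 * l2_normsq M h" for n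
      proof -
        have "(\<lambda>p. u n p + of_real c * h p) \<in> V" by (intro add scale u(1) h)
        then have "d \<le> J (\<lambda>p. u n p + of_real c * h p)" by (rule d_le)
        moreover have "\<phi> (\<lambda>p. u n p + of_real c * h p) = \<phi> (u n) + of_real c * \<phi> h"
          by (simp only: phi_scale[OF h] phi_add[OF u(1) scale[OF h]])
        ultimately show ?thesis
          using u(2)[of n] l2_normsq_add_scale[OF sqV[OF u(1)[of n]] sqV[OF h], of "of_real c"]
          by (simp add: J_def algebra_simps)
      qed
      moreover have "(\<lambda>n. 2 * c * (Re (l2_inner M (u n) h) - Re (\<phi> h)) + c\<^sup>2 * l2_normsq M h)
          \<longlonglongrightarrow> 2 * c * (Re (l2_inner M l h) - Re (\<phi> h)) + c\<^sup>2 * l2_normsq M h"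
        by (intro tendsto_intros lim)
      moreover have "(\<lambda>n. - (1 / (real n + 1))) \<longlonglongrightarrow> 0"
        using tendsto_minus[OF LIMSEQ_inverse_real_of_nat] by (simp add: inverse_eq_divide add.commute)
      ultimately show ?thesis
        by (intro LIMSEQ_le[of "\<lambda>n. - (1 / (real n + 1))"]) auto
    qed
    define D where "D = Re (l2_inner M l h) - Re (\<phi> h)"
    \<comment> \<open>the quadratic polynomial in \<open>c\<close> touches 0 at \<open>c = 0\<close>, so its linear coefficient vanishes\<close>
    have "D = 0"
    proof (cases "l2_normsq M h = 0")
      case True
      then show ?thesis using ineq[of 1] ineq[of "-1"] by (simp add: D_def)
    next
      case False
      then have pos: "l2_normsq M h > 0" using l2_normsq_nonneg[of M h] by linarith
      have "0 \<le> - D\<^sup>2 / l2_normsq M h"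
        using ineq[of "- D / l2_normsq M h"] pos by (simp add: D_def[symmetric] power2_eq_square field_simps)
      then show ?thesis using pos by (simp add: field_simps)
    qed
    then show ?thesis by (simp add: D_def)
  qed
  have "\<phi> h = l2_inner M h l" if h: "h \<in> V" for h
  proof (rule complex_eqI)
    have *: "Re (l2_inner M h l) = Re (\<phi> h)" if "h \<in> V" for h
      using Re_eq[OF that] l2_inner_swap[of M h l] by simp
    show "Re (\<phi> h) = Re (l2_inner M h l)" using *[OF h] by simp
    show "Im (\<phi> h) = Im (l2_inner M h l)"
      using *[OF scale[OF h, of \<i>]] phi_scale[OF h, of \<i>] l2_inner_scale_left[of M \<i> h l] by simp
  qed
  then show ?thesis using l by blast
qed

end

section \<open>The mean value inequality on bidiscs\<close>

lemma borel_measurable_Complex [measurable]: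
  "(\<lambda>(x, y). Complex x y) \<in> borel_measurable (lborel \<Otimes>\<^sub>M lborel)"
proof -
  have "(\<lambda>p :: real \<times> real. Complex (fst p) (snd p)) \<in> borel_measurable borel"
    by (intro borel_measurable_continuous_onI) (auto intro!: continuous_intros simp: Complex_eq)
  then show ?thesis by (simp add: lborel_prod case_prod_unfold)
qed

lemma lborel_complex_eq:
  "distr (lborel \<Otimes>\<^sub>M lborel) borel (\<lambda>(x, y). Complex x y) = lborel"
proof (rule lborel_eqI[symmetric])
  fix l u :: complex
  assume "\<And>b. b \<in> Basis \<Longrightarrow> l \<bullet> b \<le> u \<bullet> b"
  from this[of 1] this[of \<i>] have lu: "Re l \<le> Re u" "Im l \<le> Im u"
    by (auto simp: Basis_complex_def)
  have "(\<lambda>(x, y). Complex x y) -` box l u \<inter> space (lborel \<Otimes>\<^sub>M lborel)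
      = {Re l<..<Re u} \<times> {Im l<..<Im u}"
    by (auto simp: space_pair_measure in_box_complex_iff)
  then show "emeasure (distr (lborel \<Otimes>\<^sub>M lborel) borel (\<lambda>(x, y). Complex x y)) (box l u)
      = (\<Prod>b\<in>Basis. (u - l) \<bullet> b)"
    using lu by (subst emeasure_distr)
      (auto simp: lborel.emeasure_pair_measure_Times Basis_complex_def ennreal_mult)
qed simp

lemma nn_integral_complex:
  assumes "g \<in> borel_measurable borel"
  shows "(\<integral>\<^sup>+z. g z \<partial>lborel) = (\<integral>\<^sup>+x. \<integral>\<^sup>+y. g (Complex x y) \<partial>lborel \<partial>lborel)"
proof -
  have "(\<integral>\<^sup>+z. g z \<partial>lborel) = (\<integral>\<^sup>+p. g (case p of (x, y) \<Rightarrow> Complex x y) \<partial>(lborel \<Otimes>\<^sub>M lborel))"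
    by (subst lborel_complex_eq[symmetric], subst nn_integral_distr) (use assms in auto)
  also have "\<dots> = (\<integral>\<^sup>+x. \<integral>\<^sup>+y. g (Complex x y) \<partial>lborel \<partial>lborel)"
    using measurable_compose[OF borel_measurable_Complex assms]
    by (subst lborel.nn_integral_fst[symmetric]) auto
  finally show ?thesis .
qed

text \<open>
  In real coordinates the rotation by \<open>c = a + \<i> b\<close> is the map
  \<open>(x, y) \<mapsto> (a x - b y, a y + b x)\<close>. If \<open>a \<noteq> 0\<close> it factors into two maps each of which is affine in a single
  variable: first \<open>u = a x - b y\<close> for fixed \<open>y\<close>, which turns the second coordinate into
  \<open>(b u + y) / a\<close> since \<open>a\<^sup>2 + b\<^sup>2 = 1\<close>, and then \<open>v = (b u + y) / a\<close> for fixed \<open>u\<close>. The Jacobian factors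
  \<open>|a|\<close> and \<open>1 / |a|\<close> cancel. If \<open>a = 0\<close> the rotation exchanges the coordinates up to a sign.
\<close>

lemma nn_integral_rotate:
  assumes [measurable]: "g \<in> borel_measurable borel" and "cmod c = 1"
  shows "(\<integral>\<^sup>+z. g (c * z) \<partial>lborel) = (\<integral>\<^sup>+z. g z \<partial>lborel)"
proof -
  define a b where "a = Re c" and "b = Im c"
  have ab: "a\<^sup>2 + b\<^sup>2 = 1" using assms(2) by (simp add: cmod_def a_def b_def)
  have m2: "(\<lambda>(x, y). g (Complex (p x y) (q x y))) \<in> borel_measurable (lborel \<Otimes>\<^sub>M lborel)"
    if "continuous_on UNIV (\<lambda>z. p (fst z) (snd z))" "continuous_on UNIV (\<lambda>z. q (fst z) (snd z))"
    for p q :: "real \<Rightarrow> real \<Rightarrow> real"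
  proof -
    have "(\<lambda>z. Complex (p (fst z) (snd z)) (q (fst z) (snd z))) \<in> borel_measurable borel"
      using that by (intro borel_measurable_continuous_onI)
        (auto intro!: continuous_intros simp: Complex_eq)
    from measurable_compose[OF this assms(1)] show ?thesis
      by (simp add: lborel_prod case_prod_unfold)
  qed
  have m1: "(\<lambda>x. g (Complex (p x) (q x))) \<in> borel_measurable borel"
    if "continuous_on UNIV p" "continuous_on UNIV q" for p q :: "real \<Rightarrow> real"
  proof -
    have "(\<lambda>z. Complex (p z) (q z)) \<in> borel_measurable borel"
      using that by (intro borel_measurable_continuous_onI)
        (auto intro!: continuous_intros simp: Complex_eq)
    from measurable_compose[OF this assms(1)] show ?thesis .
  qed
  have cm: "(\<lambda>z. g (c * z)) \<in> borel_measurable borel" by measurable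
  have mult: "c * Complex x y = Complex (a * x - b * y) (a * y + b * x)" for x y
    by (simp add: complex_eq_iff a_def b_def)
  have meas1: "(\<lambda>y. \<integral>\<^sup>+x. g (Complex (p x y) (q x y)) \<partial>lborel) \<in> borel_measurable lborel"
      if "continuous_on UNIV (\<lambda>z. p (snd z) (fst z))" "continuous_on UNIV (\<lambda>z. q (snd z) (fst z))"
    for p q :: "real \<Rightarrow> real \<Rightarrow> real"
      using lborel.borel_measurable_nn_integral_fst[OF m2[of "\<lambda>y x. p x y" "\<lambda>y x. q x y"]] that by simp
  have step: "(\<integral>\<^sup>+y. \<integral>\<^sup>+x. g (Complex (a * x - b * y) (a * y + b * x)) \<partial>lborel \<partial>lborel)
      = (\<integral>\<^sup>+x. \<integral>\<^sup>+y. g (Complex x y) \<partial>lborel \<partial>lborel)"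
  proof (cases "a = 0")
    case True
    then have b1: "\<bar>b\<bar> = 1" "b \<noteq> 0" using ab by (auto simp: abs_square_eq_1)
    have "(\<integral>\<^sup>+x. g (Complex (- b * y) (b * x)) \<partial>lborel) = (\<integral>\<^sup>+x. g (Complex (- b * y) x) \<partial>lborel)" for y
      using nn_integral_real_affine[OF m1[of "\<lambda>x. - b * y" "\<lambda>x. x"] b1(2), of 0] b1
      by (auto intro!: continuous_intros)
    moreover have "(\<integral>\<^sup>+y. \<integral>\<^sup>+x. g (Complex y x) \<partial>lborel \<partial>lborel)
        = ennreal \<bar>- b\<bar> * (\<integral>\<^sup>+y. \<integral>\<^sup>+x. g (Complex (0 + - b * y) x) \<partial>lborel \<partial>lborel)"
      by (rule nn_integral_real_affine)
        (use b1 meas1[of "\<lambda>x y. y" "\<lambda>x y. x"] in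
          \<open>auto simp: continuous_on_fst continuous_on_snd continuous_on_id\<close>)
    ultimately show ?thesis using True b1 by simp
  next
    case False
    have inner: "(\<integral>\<^sup>+u. g (Complex u ((b * u + y) / a)) \<partial>lborel)
        = ennreal \<bar>a\<bar> * (\<integral>\<^sup>+x. g (Complex (a * x - b * y) (a * y + b * x)) \<partial>lborel)" for y
    proof -
      have "(b * (- b * y + a * x) + y) / a = a * y + b * x" for x
      proof -
        have "b * (- b * y + a * x) + y = a * (a * y + b * x) - (a\<^sup>2 + b\<^sup>2) * y + y"
          by (simp add: power2_eq_square algebra_simps)
        then show ?thesis using False ab by simp
      qed
      then show ?thesis
        using False
        by (subst nn_integral_real_affine[OF m1 False, where t = "- b * y"])
          (auto intro!: continuous_intros)
    qed
    have outer: "(\<integral>\<^sup>+y. g (Complex u ((b * u + y) / a)) \<partial>lborel)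
        = ennreal \<bar>a\<bar> * (\<integral>\<^sup>+v. g (Complex u v) \<partial>lborel)" for u
    proof -
      have "(b * u + (- (b * u) + a * v)) / a = v" for v using False by simp
      then show ?thesis
        by (subst nn_integral_real_affine[OF m1 False, where t = "- (b * u)"])
          (use False in \<open>auto intro!: continuous_intros\<close>)
    qed
    have "ennreal \<bar>a\<bar> * (\<integral>\<^sup>+y. \<integral>\<^sup>+x. g (Complex (a * x - b * y) (a * y + b * x)) \<partial>lborel \<partial>lborel)
        = (\<integral>\<^sup>+y. \<integral>\<^sup>+u. g (Complex u ((b * u + y) / a)) \<partial>lborel \<partial>lborel)"
      unfolding inner by (rule nn_integral_cmult[symmetric], rule meas1) (auto intro!: continuous_intros)
    also have "\<dots> = (\<integral>\<^sup>+u. \<integral>\<^sup>+y. g (Complex u ((b * u + y) / a)) \<partial>lborel \<partial>lborel)"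
      by (rule lborel_pair.Fubini', rule m2) (use False in \<open>auto intro!: continuous_intros\<close>)
    also have "\<dots> = ennreal \<bar>a\<bar> * (\<integral>\<^sup>+u. \<integral>\<^sup>+v. g (Complex u v) \<partial>lborel \<partial>lborel)"
      unfolding outer
      by (rule nn_integral_cmult, rule meas1[of "\<lambda>x y. y" "\<lambda>x y. x"]) (auto intro!: continuous_intros)
    finally show ?thesis
      using False by (simp add: ennreal_mult_cancel_left)
  qed
  have "(\<integral>\<^sup>+z. g (c * z) \<partial>lborel)
      = (\<integral>\<^sup>+x. \<integral>\<^sup>+y. g (Complex (a * x - b * y) (a * y + b * x)) \<partial>lborel \<partial>lborel)"
    unfolding nn_integral_complex[OF cm] mult ..
  also have "\<dots> = (\<integral>\<^sup>+y. \<integral>\<^sup>+x. g (Complex (a * x - b * y) (a * y + b * x)) \<partial>lborel \<partial>lborel)"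
    by (rule lborel_pair.Fubini'[symmetric], rule m2) (auto intro!: continuous_intros)
  also have "\<dots> = (\<integral>\<^sup>+x. \<integral>\<^sup>+y. g (Complex x y) \<partial>lborel \<partial>lborel)" by (rule step)
  also have "\<dots> = (\<integral>\<^sup>+z. g z \<partial>lborel)" by (rule nn_integral_complex[symmetric]) simp
  finally show ?thesis .
qed

lemma nn_integral_translate:
  fixes g :: "complex \<Rightarrow> ennreal"
  assumes "g \<in> borel_measurable borel"
  shows "(\<integral>\<^sup>+z. g (a + z) \<partial>lborel) = (\<integral>\<^sup>+z. g z \<partial>lborel)"
  by (subst (2) lborel_distr_plus[of a, symmetric], subst nn_integral_distr) (use assms in auto)

lemma circle_mean:
  fixes g :: "complex \<Rightarrow> complex"
  assumes "continuous_on (cball 0 1) g" "g holomorphic_on ball 0 1"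
  shows "((\<lambda>t. g (cis t)) has_integral 2 * pi * g 0) {0..2*pi}"
proof -
  have "((\<lambda>u. g u / (u - 0)) has_contour_integral 2 * of_real pi * \<i> * g 0) (circlepath 0 1)"
    by (intro Cauchy_integral_circlepath assms) auto
  then have "((\<lambda>t. g (cis t) / cis t * \<i> * cis t) has_integral 2 * of_real pi * \<i> * g 0) {0..2*pi}"
    unfolding circlepath_def
    by (subst (asm) has_contour_integral_part_circlepath_iff) auto
  then have "((\<lambda>t. - \<i> * (g (cis t) / cis t * \<i> * cis t)) has_integral
      - \<i> * (2 * of_real pi * \<i> * g 0)) {0..2*pi}"
    by (rule has_integral_mult_right)
  moreover have "- \<i> * (g (cis t) / cis t * \<i> * cis t) = g (cis t)" for t
    by (simp add: mult.commute)
  moreover have "- \<i> * (2 * of_real pi * \<i> * g 0) = 2 * of_real pi * g 0"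
    by (simp add: mult.left_commute)
  ultimately show ?thesis by (simp only:) simp
qed

lemma circle_submean:
  fixes g :: "complex \<Rightarrow> complex"
  assumes "continuous_on (cball 0 1) g" "g holomorphic_on ball 0 1"
  shows "ennreal (2 * pi * cmod (g 0)) \<le> (\<integral>\<^sup>+t. indicator {0..2*pi} t * ennreal (cmod (g (cis t))) \<partial>lborel)"
proof -
  have cont: "continuous_on {0..2*pi} (\<lambda>t. cmod (g (cis t)))"
    by (intro continuous_on_norm continuous_on_compose2[OF assms(1)]) (auto intro!: continuous_intros)
  then have I: "((\<lambda>t. cmod (g (cis t))) has_integral integral {0..2*pi} (\<lambda>t. cmod (g (cis t)))) {0..2*pi}"
    by (intro integrable_integral integrable_continuous_interval)
  have "2 * pi * cmod (g 0) = cmod (integral {0..2*pi} (\<lambda>t. g (cis t)))"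
    using integral_unique[OF circle_mean[OF assms]] by (simp add: norm_mult)
  also have "\<dots> \<le> integral {0..2*pi} (\<lambda>t. cmod (g (cis t)))"
    using circle_mean[OF assms] I by (intro integral_norm_bound_integral) auto
  finally have "ennreal (2 * pi * cmod (g 0)) \<le> ennreal (integral {0..2*pi} (\<lambda>t. cmod (g (cis t))))"
    by (rule ennreal_leI)
  also have "\<dots> = (\<integral>\<^sup>+t. indicator {0..2*pi} t * ennreal (cmod (g (cis t))) \<partial>lborel)"
    using nn_integral_has_integral_lebesgue[OF _ I] by (simp add: ennreal_mult' ennreal_indicator)
  finally show ?thesis .
qed

text \<open>
  The circle mean inequality holds on the circle through every point \<open>a + z\<close> of the disc. Integrating
  it over \<open>z\<close> and exchanging the order of integration leaves, for each angle, the integral over a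
  rotated disc, which by rotation invariance does not depend on the angle. This replaces polar
  coordinates.
\<close>

lemma area_submean:
  assumes "open S" "g holomorphic_on S" and sub: "cball a r \<subseteq> S"
  shows "ennreal (cmod (g a)) * emeasure lborel (cball a r)
      \<le> (\<integral>\<^sup>+z. indicator (cball a r) z * ennreal (cmod (g z)) \<partial>lborel)"
proof -
  define \<Psi> where "\<Psi> z = indicator (cball 0 r) z * ennreal (cmod (g (a + z)))" for z
  have cball: "a + z \<in> cball a r \<longleftrightarrow> z \<in> cball 0 r" for z by (simp add: dist_norm)
  have contg: "continuous_on S g" using assms holomorphic_on_imp_continuous_on by blast
  have "(\<lambda>z. indicator (cball 0 r) z *\<^sub>R cmod (g (a + z))) \<in> borel_measurable borel"
    using sub cball by (intro borel_measurable_continuous_on_indicator continuous_on_norm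
        continuous_on_compose2[OF contg]) (auto intro!: continuous_intros)
  then have meas [measurable]: "\<Psi> \<in> borel_measurable borel"
    unfolding \<Psi>_def by (simp add: ennreal_mult' ennreal_indicator[symmetric] flip: ennreal_mult')
  have "(\<lambda>z. \<Psi> (z - a)) \<in> borel_measurable borel" by measurable
  from nn_integral_translate[OF this, of a]
  have I: "(\<integral>\<^sup>+z. \<Psi> z \<partial>lborel) = (\<integral>\<^sup>+z. indicator (cball a r) z * ennreal (cmod (g z)) \<partial>lborel)"
    by (simp add: \<Psi>_def indicator_def dist_norm norm_minus_commute)
  have pt: "ennreal (2 * pi * cmod (g a)) * indicator (cball 0 r) z
      \<le> (\<integral>\<^sup>+t. indicator {0..2*pi} t * \<Psi> (cis t * z) \<partial>lborel)" for z
  proof (cases "z \<in> cball 0 r")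
    case True
    have in_ball: "a + z * v \<in> cball a r" if "cmod v \<le> 1" for v
      using True mult_left_mono[OF that, of "cmod z"] by (simp add: dist_norm norm_mult)
    have "(\<lambda>v. g (a + z * v)) holomorphic_on ball 0 1"
      using in_ball sub by (intro holomorphic_on_compose_gen[OF _ assms(2), unfolded o_def])
        (auto intro!: holomorphic_intros)
    moreover have "continuous_on (cball 0 1) (\<lambda>v. g (a + z * v))"
      using in_ball sub by (intro continuous_on_compose2[OF contg]) (auto intro!: continuous_intros)
    ultimately have "ennreal (2 * pi * cmod (g a))
        \<le> (\<integral>\<^sup>+t. indicator {0..2*pi} t * ennreal (cmod (g (a + z * cis t))) \<partial>lborel)"
      using circle_submean[of "\<lambda>v. g (a + z * v)"] by simp
    also have "\<dots> = (\<integral>\<^sup>+t. indicator {0..2*pi} t * \<Psi> (cis t * z) \<partial>lborel)"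
      using True by (simp add: \<Psi>_def norm_mult mult.commute)
    finally show ?thesis using True by simp
  qed simp
  have [measurable]: "cis \<in> borel_measurable borel"
    by (intro borel_measurable_continuous_onI continuous_intros)
  have "ennreal (2 * pi * cmod (g a)) * emeasure lborel (cball (0::complex) r)
      = (\<integral>\<^sup>+z. ennreal (2 * pi * cmod (g a)) * indicator (cball (0::complex) r) z \<partial>lborel)"
    by (simp add: nn_integral_cmult_indicator)
  also have "\<dots> \<le> (\<integral>\<^sup>+z. \<integral>\<^sup>+t. indicator {0..2*pi} t * \<Psi> (cis t * z) \<partial>lborel \<partial>lborel)"
    by (intro nn_integral_mono pt)
  also have "\<dots> = (\<integral>\<^sup>+t. \<integral>\<^sup>+z. indicator {0..2*pi} t * \<Psi> (cis t * z) \<partial>lborel \<partial>lborel)"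
    by (rule lborel_pair.Fubini') measurable
  also have "\<dots> = (\<integral>\<^sup>+t. indicator {0..2*pi} t * (\<integral>\<^sup>+z. \<Psi> z \<partial>lborel) \<partial>lborel)"
    by (intro nn_integral_cong) (simp add: nn_integral_cmult nn_integral_rotate)
  also have "\<dots> = ennreal (2 * pi) * (\<integral>\<^sup>+z. \<Psi> z \<partial>lborel)"
    by (simp add: nn_integral_multc)
  finally have "ennreal (2 * pi) * (ennreal (cmod (g a)) * emeasure lborel (cball (0::complex) r))
      \<le> ennreal (2 * pi) * (\<integral>\<^sup>+z. \<Psi> z \<partial>lborel)"
    by (simp add: ennreal_mult mult.assoc)
  then have "ennreal (cmod (g a)) * emeasure lborel (cball (0::complex) r) \<le> (\<integral>\<^sup>+z. \<Psi> z \<partial>lborel)"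
    by (subst (asm) ennreal_mult_le_mult_iff) auto
  moreover have "emeasure lborel (cball (0::complex) r) = emeasure lborel (cball a r)"
  proof -
    have "(\<integral>\<^sup>+z. indicator (cball (0::complex) r) z \<partial>lborel) = (\<integral>\<^sup>+z. indicator (cball a r) (a + z) \<partial>lborel)"
      by (intro nn_integral_cong) (simp add: dist_norm indicator_def)
    also have "\<dots> = (\<integral>\<^sup>+z. indicator (cball a r) z \<partial>lborel)" by (intro nn_integral_translate borel_measurable_indicator) simp
    finally show ?thesis by (simp only: nn_integral_indicator sets_lborel borel_closed closed_cball)
  qed
  ultimately show ?thesis by (simp add: I)
qed

text \<open>
  The square of a holomorphic function is holomorphic, so the inequality for the modulus contains the
  one for its square.
\<close>

lemma area_submean_sq:
  assumes "open S" "g holomorphic_on S" "cball a r \<subseteq> S"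
  shows "ennreal ((cmod (g a))\<^sup>2) * emeasure lborel (cball a r)
      \<le> (\<integral>\<^sup>+z. indicator (cball a r) z * ennreal ((cmod (g z))\<^sup>2) \<partial>lborel)"
  using area_submean[OF assms(1) holomorphic_on_power[OF assms(2), of 2] assms(3)]
  by (simp add: norm_power)

lemma emeasure_cball_complex:
  "r \<ge> 0 \<Longrightarrow> emeasure lborel (cball (a::complex) r) = ennreal (pi * r\<^sup>2)"
  by (simp add: emeasure_cball unit_ball_vol_2)

lemma holomorphic2_slices:
  assumes "open \<Omega>" "holomorphic2_on h \<Omega>"
  shows "open {z. (z, w) \<in> \<Omega>}" "(\<lambda>z. h (z, w)) holomorphic_on {z. (z, w) \<in> \<Omega>}"
    and "open {w. (z, w) \<in> \<Omega>}" "(\<lambda>w. h (z, w)) holomorphic_on {w. (z, w) \<in> \<Omega>}"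
proof -
  have "open ((\<lambda>z. (z, w)) -` \<Omega>)" by (rule open_vimage[OF assms(1)]) (auto intro!: continuous_intros)
  then show 1: "open {z. (z, w) \<in> \<Omega>}" by (simp add: vimage_def)
  have "open ((\<lambda>w. (z, w)) -` \<Omega>)" by (rule open_vimage[OF assms(1)]) (auto intro!: continuous_intros)
  then show 2: "open {w. (z, w) \<in> \<Omega>}" by (simp add: vimage_def)
  show "(\<lambda>z. h (z, w)) holomorphic_on {z. (z, w) \<in> \<Omega>}"
    unfolding holomorphic_on_open[OF 1]
  proof
    fix z assume "z \<in> {z. (z, w) \<in> \<Omega>}"
    then obtain a b where "(h has_derivative (\<lambda>v. a * fst v + b * snd v)) (at (z, w))"
      using assms(2) unfolding holomorphic2_on_def by blast
    moreover have "((\<lambda>z. (z, w)) has_derivative (\<lambda>v. (v, 0))) (at z)"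
      by (intro has_derivative_Pair has_derivative_ident has_derivative_const)
    ultimately have "((\<lambda>z. h (z, w)) has_derivative (\<lambda>v. a * v)) (at z)"
      using has_derivative_compose by fastforce
    then show "\<exists>f'. ((\<lambda>z. h (z, w)) has_field_derivative f') (at z)"
      by (auto simp: has_field_derivative_def)
  qed
  show "(\<lambda>w. h (z, w)) holomorphic_on {w. (z, w) \<in> \<Omega>}"
    unfolding holomorphic_on_open[OF 2]
  proof
    fix w assume "w \<in> {w. (z, w) \<in> \<Omega>}"
    then obtain a b where "(h has_derivative (\<lambda>v. a * fst v + b * snd v)) (at (z, w))"
      using assms(2) unfolding holomorphic2_on_def by blast
    moreover have "((\<lambda>w. (z, w)) has_derivative (\<lambda>v. (0, v))) (at w)"
      by (intro has_derivative_Pair has_derivative_ident has_derivative_const)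
    ultimately have "((\<lambda>w. h (z, w)) has_derivative (\<lambda>v. b * v)) (at w)"
      using has_derivative_compose by fastforce
    then show "\<exists>f'. ((\<lambda>w. h (z, w)) has_field_derivative f') (at w)"
      by (auto simp: has_field_derivative_def)
  qed
qed

lemma holomorphic2_continuous_on:
  assumes "holomorphic2_on h \<Omega>"
  shows "continuous_on \<Omega> h"
  using assms unfolding holomorphic2_on_def
  by (meson continuous_at_imp_continuous_on has_derivative_continuous)

lemma polydisc_submean:
  assumes "open \<Omega>" "holomorphic2_on h \<Omega>" and "r \<ge> 0" "R \<ge> 0"
    and sub: "cball z0 r \<times> cball w0 R \<subseteq> \<Omega>"
  shows "ennreal ((cmod (h (z0, w0)))\<^sup>2 * (pi * r\<^sup>2 * (pi * R\<^sup>2)))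
      \<le> (\<integral>\<^sup>+p. indicator (cball z0 r \<times> cball w0 R) p * ennreal ((cmod (h p))\<^sup>2) \<partial>lborel)"
proof -
  let ?D = "cball z0 r" and ?E = "cball w0 R"
  let ?H = "\<lambda>p. indicator (?D \<times> ?E) p * ennreal ((cmod (h p))\<^sup>2)"
  have "(\<lambda>p. indicator (?D \<times> ?E) p *\<^sub>R (cmod (h p))\<^sup>2) \<in> borel_measurable borel"
    by (intro borel_measurable_continuous_on_indicator continuous_on_power continuous_on_norm
        continuous_on_subset[OF holomorphic2_continuous_on[OF assms(2)] sub])
      (auto intro!: borel_closed closed_Times)
  then have H [measurable]: "?H \<in> borel_measurable (lborel \<Otimes>\<^sub>M lborel)"
    by (simp add: lborel_prod ennreal_indicator[symmetric] flip: ennreal_mult')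
  have inner: "indicator ?D z * (ennreal ((cmod (h (z, w0)))\<^sup>2) * ennreal (pi * R\<^sup>2))
      \<le> (\<integral>\<^sup>+w. ?H (z, w) \<partial>lborel)" for z
  proof (cases "z \<in> ?D")
    case True
    then have "?E \<subseteq> {w. (z, w) \<in> \<Omega>}" using sub by auto
    from area_submean_sq[OF holomorphic2_slices(3,4)[OF assms(1,2)] this]
    show ?thesis using True \<open>R \<ge> 0\<close> by (simp add: emeasure_cball_complex indicator_times)
  qed simp
  have "?D \<subseteq> {z. (z, w0) \<in> \<Omega>}" using sub \<open>R \<ge> 0\<close> by auto
  from area_submean_sq[OF holomorphic2_slices(1,2)[OF assms(1,2)] this]
  have outer: "ennreal ((cmod (h (z0, w0)))\<^sup>2) * ennreal (pi * r\<^sup>2)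
      \<le> (\<integral>\<^sup>+z. indicator ?D z * ennreal ((cmod (h (z, w0)))\<^sup>2) \<partial>lborel)"
    using \<open>r \<ge> 0\<close> by (simp add: emeasure_cball_complex)
  have "continuous_on ?D (\<lambda>z. h (z, w0))"
    using \<open>?D \<subseteq> {z. (z, w0) \<in> \<Omega>}\<close>
      holomorphic_on_imp_continuous_on[OF holomorphic2_slices(2)[OF assms(1,2)]] continuous_on_subset by blast
  then have "(\<lambda>z. indicator ?D z *\<^sub>R (cmod (h (z, w0)))\<^sup>2) \<in> borel_measurable borel"
    by (intro borel_measurable_continuous_on_indicator continuous_on_power continuous_on_norm) auto
  then have m: "(\<lambda>z. indicator ?D z * ennreal ((cmod (h (z, w0)))\<^sup>2)) \<in> borel_measurable lborel"
    by (simp add: ennreal_indicator[symmetric] flip: ennreal_mult')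
  have "ennreal ((cmod (h (z0, w0)))\<^sup>2 * (pi * r\<^sup>2 * (pi * R\<^sup>2)))
      = ennreal ((cmod (h (z0, w0)))\<^sup>2) * ennreal (pi * r\<^sup>2) * ennreal (pi * R\<^sup>2)"
    by (simp add: ennreal_mult' mult.assoc)
  also have "\<dots> \<le> (\<integral>\<^sup>+z. indicator ?D z * ennreal ((cmod (h (z, w0)))\<^sup>2) \<partial>lborel) * ennreal (pi * R\<^sup>2)"
    by (intro mult_right_mono outer) simp
  also have "\<dots> = (\<integral>\<^sup>+z. indicator ?D z * (ennreal ((cmod (h (z, w0)))\<^sup>2) * ennreal (pi * R\<^sup>2)) \<partial>lborel)"
    by (subst nn_integral_multc[symmetric, OF m]) (simp add: mult.assoc)
  also have "\<dots> \<le> (\<integral>\<^sup>+z. \<integral>\<^sup>+w. ?H (z, w) \<partial>lborel \<partial>lborel)"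
    by (intro nn_integral_mono inner)
  also have "\<dots> = (\<integral>\<^sup>+p. ?H p \<partial>lborel)"
    by (subst lborel.nn_integral_fst[OF H]) (simp add: lborel_prod)
  finally show ?thesis .
qed

section \<open>The Bergman space and the extremal property of its kernel\<close>

lemma L2_on_eq: "L2_on \<Omega> = sq_integrable (lebesgue_on \<Omega>)"
  by (simp add: L2_on_def sq_integrable_def)

lemma nn_integral_eq_l2_normsq:
  assumes "h \<in> sq_integrable M"
  shows "(\<integral>\<^sup>+p. ennreal ((cmod (h p))\<^sup>2) \<partial>M) = ennreal (l2_normsq M h)"
  unfolding l2_normsq_def using sq_integrableD(2)[OF assms] by (intro nn_integral_eq_integral) auto

lemma sq_integrable_iff_nn_integral:
  "h \<in> sq_integrable M \<longleftrightarrow>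
    h \<in> borel_measurable M \<and> (\<integral>\<^sup>+p. ennreal ((cmod (h p))\<^sup>2) \<partial>M) < \<infinity>"
  by (auto simp: sq_integrable_def integrable_iff_bounded)

lemma nn_integral_lebesgue_on_open:
  assumes "open \<Omega>"
  shows "(\<integral>\<^sup>+p. g p \<partial>lebesgue_on \<Omega>) = (\<integral>\<^sup>+p. g p * indicator \<Omega> p \<partial>lborel)"
proof -
  have "\<Omega> \<inter> space lebesgue \<in> sets lebesgue" using assms by simp
  from nn_integral_restrict_space[OF this] show ?thesis by (simp add: nn_integral_completion)
qed

lemma bergman_point_bound:
  assumes "open \<Omega>" and h: "h \<in> bergman_space \<Omega>" and "r \<ge> 0" "R \<ge> 0"
    and sub: "cball z0 r \<times> cball w0 R \<subseteq> \<Omega>"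
  shows "(cmod (h (z0, w0)))\<^sup>2 * (pi * r\<^sup>2 * (pi * R\<^sup>2)) \<le> l2_normsq (lebesgue_on \<Omega>) h"
proof -
  have hol: "holomorphic2_on h \<Omega>" and sq: "h \<in> sq_integrable (lebesgue_on \<Omega>)"
    using h by (auto simp: bergman_space_def L2_on_eq)
  have "ennreal ((cmod (h (z0, w0)))\<^sup>2 * (pi * r\<^sup>2 * (pi * R\<^sup>2)))
      \<le> (\<integral>\<^sup>+p. indicator (cball z0 r \<times> cball w0 R) p * ennreal ((cmod (h p))\<^sup>2) \<partial>lborel)"
    by (rule polydisc_submean[OF assms(1) hol assms(3-5)])
  also have "\<dots> \<le> (\<integral>\<^sup>+p. ennreal ((cmod (h p))\<^sup>2) * indicator \<Omega> p \<partial>lborel)"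
    using sub by (intro nn_integral_mono) (auto simp: indicator_def)
  also have "\<dots> = ennreal (l2_normsq (lebesgue_on \<Omega>) h)"
    by (simp add: nn_integral_lebesgue_on_open[OF assms(1), symmetric] nn_integral_eq_l2_normsq[OF sq])
  finally show ?thesis by simp
qed

text \<open>
  Membership in the Bergman space controls values (by the mean value inequality on small polydiscs)
  and then both partial derivatives (by Cauchy's inequality on the slices), uniformly near a point.
  This is what makes convergence in norm imply locally uniform convergence of functions and
  derivatives.
\<close>

lemma bergman_local_bound:
  assumes "open \<Omega>" "(z0, w0) \<in> \<Omega>"
  obtains K d where "K > 0" "d > 0" "cball z0 d \<times> cball w0 d \<subseteq> \<Omega>"
    "\<forall>h\<in>bergman_space \<Omega>. \<forall>x\<in>cball z0 d \<times> cball w0 d.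
        cmod (h x) \<le> K * sqrt (l2_normsq (lebesgue_on \<Omega>) h)"
    "\<forall>h\<in>bergman_space \<Omega>. \<forall>x\<in>cball z0 d \<times> cball w0 d. \<forall>a b.
        (h has_derivative (\<lambda>v. a * fst v + b * snd v)) (at x) \<longrightarrow>
        cmod a \<le> K * sqrt (l2_normsq (lebesgue_on \<Omega>) h) \<and> cmod b \<le> K * sqrt (l2_normsq (lebesgue_on \<Omega>) h)"
proof -
  let ?n = "l2_normsq (lebesgue_on \<Omega>)"
  obtain A B where AB: "open A" "open B" "(z0, w0) \<in> A \<times> B" "A \<times> B \<subseteq> \<Omega>"
    by (rule open_prod_elim[OF assms])
  have z0: "z0 \<in> A" and w0: "w0 \<in> B" using AB(3) by auto
  obtain e1 where e1: "e1 > 0" "cball z0 e1 \<subseteq> A"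
    using AB(1) z0 unfolding open_contains_cball by blast
  obtain e2 where e2: "e2 > 0" "cball w0 e2 \<subseteq> B"
    using AB(2) w0 unfolding open_contains_cball by blast
  \<comment> \<open>a third of the available radius: points are taken in the polydisc of radius \<open>d\<close>, Cauchy's
     inequality leads to radius \<open>2 d\<close>, and the mean value inequality to radius \<open>3 d\<close>\<close>
  define d where "d = min e1 e2 / 3"
  have d: "d > 0" using e1 e2 by (simp add: d_def)
  have "cball z0 (3 * d) \<subseteq> cball z0 e1" "cball w0 (3 * d) \<subseteq> cball w0 e2"
    by (auto simp: d_def)
  then have sub3: "cball z0 (3 * d) \<times> cball w0 (3 * d) \<subseteq> \<Omega>"
    using e1(2) e2(2) AB(4) by blast
  have sub: "cball z d \<times> cball w d \<subseteq> \<Omega>" if "dist z0 z \<le> 2 * d" "dist w0 w \<le> 2 * d" for z w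
  proof -
    have "cball a d \<subseteq> cball a0 (3 * d)" if "dist a0 a \<le> 2 * d" for a a0 :: complex
    proof
      fix b assume "b \<in> cball a d"
      then show "b \<in> cball a0 (3 * d)" using dist_triangle[of a0 b a] that by simp
    qed
    then have "cball z d \<subseteq> cball z0 (3 * d)" "cball w d \<subseteq> cball w0 (3 * d)" using that by blast+
    then show ?thesis using sub3 by blast
  qed
  define K0 where "K0 = 1 / (pi * d\<^sup>2)"
  have K0: "K0 > 0" using d by (simp add: K0_def)
  have val: "cmod (h (z, w)) \<le> K0 * sqrt (?n h)"
    if "h \<in> bergman_space \<Omega>" "dist z0 z \<le> 2 * d" "dist w0 w \<le> 2 * d" for h z w
  proof -
    have "(cmod (h (z, w)))\<^sup>2 * (pi * d\<^sup>2 * (pi * d\<^sup>2)) \<le> ?n h"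
      using bergman_point_bound[OF assms(1) that(1) _ _ sub[OF that(2,3)]] d by simp
    then have "(cmod (h (z, w)) * (pi * d\<^sup>2))\<^sup>2 \<le> ?n h"
      by (simp add: power2_eq_square mult_ac)
    then have "cmod (h (z, w)) * (pi * d\<^sup>2) \<le> sqrt (?n h)"
      by (rule real_le_rsqrt)
    then show ?thesis using d by (simp add: K0_def field_simps)
  qed
  define K where "K = max K0 (K0 / d)"
  have K: "K0 * s \<le> K * s" "K0 * s / d \<le> K * s" if "s \<ge> 0" for s
    using mult_right_mono[of K0 K s] mult_right_mono[of "K0 / d" K s] that by (auto simp: K_def)
  show thesis
  proof
    show "K > 0" using K0 by (simp add: K_def)
    show "d > 0" by fact
    show "cball z0 d \<times> cball w0 d \<subseteq> \<Omega>" using sub[of z0 w0] d by simp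
  next
    show "\<forall>h\<in>bergman_space \<Omega>. \<forall>x\<in>cball z0 d \<times> cball w0 d. cmod (h x) \<le> K * sqrt (?n h)"
    proof (intro ballI)
      fix h x assume h: "h \<in> bergman_space \<Omega>" and x: "x \<in> cball z0 d \<times> cball w0 d"
      obtain z w where zw: "x = (z, w)" "dist z0 z \<le> d" "dist w0 w \<le> d" using x by auto
      show "cmod (h x) \<le> K * sqrt (?n h)"
        using val[OF h, of z w] zw d K(1)[of "sqrt (?n h)"] by simp
    qed
  next
    show "\<forall>h\<in>bergman_space \<Omega>. \<forall>x\<in>cball z0 d \<times> cball w0 d. \<forall>a b.
        (h has_derivative (\<lambda>v. a * fst v + b * snd v)) (at x) \<longrightarrow>
        cmod a \<le> K * sqrt (?n h) \<and> cmod b \<le> K * sqrt (?n h)"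
    proof (intro ballI allI impI)
      fix h x a b assume h: "h \<in> bergman_space \<Omega>" and x: "x \<in> cball z0 d \<times> cball w0 d"
        and der: "(h has_derivative (\<lambda>v. a * fst v + b * snd v)) (at x)"
      obtain z w where zw: "x = (z, w)" "dist z0 z \<le> d" "dist w0 w \<le> d" using x by auto
      have hol: "holomorphic2_on h \<Omega>" using h by (simp add: bergman_space_def)
      have tri: "dist z0 z' \<le> 2 * d" if "dist z z' \<le> d" for z'
        using dist_triangle[of z0 z' z] that zw by simp
      have tri': "dist w0 w' \<le> 2 * d" if "dist w w' \<le> d" for w'
        using dist_triangle[of w0 w' w] that zw by simp
      have in\<Omega>: "(z', w') \<in> \<Omega>" if "dist z z' \<le> d" "dist w w' \<le> d" for z' w'
        using sub[OF tri[OF that(1)] tri'[OF that(2)]] d by auto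
      have "((\<lambda>z. (z, w)) has_derivative (\<lambda>v. (v, 0))) (at z)"
        by (intro has_derivative_Pair has_derivative_ident has_derivative_const)
      from has_derivative_compose[OF this der[unfolded zw(1)]]
      have "((\<lambda>z. h (z, w)) has_field_derivative a) (at z)"
        by (simp add: has_field_derivative_def)
      then have "deriv (\<lambda>z. h (z, w)) z = a" by (rule DERIV_imp_deriv)
      moreover have "cmod ((deriv ^^ 1) (\<lambda>z. h (z, w)) z) \<le> fact 1 * (K0 * sqrt (?n h)) / d ^ 1"
      proof (rule Cauchy_inequality)
        have "cball z d \<subseteq> {z. (z, w) \<in> \<Omega>}" using in\<Omega> d by auto
        from holomorphic_on_subset[OF holomorphic2_slices(2)[OF assms(1) hol] this]
        have "(\<lambda>z. h (z, w)) holomorphic_on cball z d" .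
        then show "(\<lambda>z. h (z, w)) holomorphic_on ball z d" "continuous_on (cball z d) (\<lambda>z. h (z, w))"
          using holomorphic_on_subset[OF _ ball_subset_cball] holomorphic_on_imp_continuous_on by blast+
        show "cmod (h (z', w)) \<le> K0 * sqrt (?n h)" if "cmod (z - z') = d" for z'
          using that tri[of z'] zw d by (intro val h) (auto simp: dist_norm)
      qed fact
      ultimately have a: "cmod a \<le> K0 * sqrt (?n h) / d" by simp
      have "((\<lambda>w. (z, w)) has_derivative (\<lambda>v. (0, v))) (at w)"
        by (intro has_derivative_Pair has_derivative_ident has_derivative_const)
      from has_derivative_compose[OF this der[unfolded zw(1)]]
      have "((\<lambda>w. h (z, w)) has_field_derivative b) (at w)"
        by (simp add: has_field_derivative_def)
      then have "deriv (\<lambda>w. h (z, w)) w = b" by (rule DERIV_imp_deriv)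
      moreover have "cmod ((deriv ^^ 1) (\<lambda>w. h (z, w)) w) \<le> fact 1 * (K0 * sqrt (?n h)) / d ^ 1"
      proof (rule Cauchy_inequality)
        have "cball w d \<subseteq> {w. (z, w) \<in> \<Omega>}" using in\<Omega> d by auto
        from holomorphic_on_subset[OF holomorphic2_slices(4)[OF assms(1) hol] this]
        have "(\<lambda>w. h (z, w)) holomorphic_on cball w d" .
        then show "(\<lambda>w. h (z, w)) holomorphic_on ball w d" "continuous_on (cball w d) (\<lambda>w. h (z, w))"
          using holomorphic_on_subset[OF _ ball_subset_cball] holomorphic_on_imp_continuous_on by blast+
        show "cmod (h (z, w')) \<le> K0 * sqrt (?n h)" if "cmod (w - w') = d" for w'
          using that tri'[of w'] zw d by (intro val h) (auto simp: dist_norm)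
      qed fact
      ultimately have b: "cmod b \<le> K0 * sqrt (?n h) / d" by simp
      show "cmod a \<le> K * sqrt (?n h) \<and> cmod b \<le> K * sqrt (?n h)"
        using a b K(2)[of "sqrt (?n h)"] by simp
    qed
  qed
qed

lemma bergman_evaluation_bounded:
  assumes "open \<Omega>" "p \<in> \<Omega>"
  obtains C where "C \<ge> 0"
    "\<forall>h\<in>bergman_space \<Omega>. (cmod (h p))\<^sup>2 \<le> C * l2_normsq (lebesgue_on \<Omega>) h"
proof -
  have p: "(fst p, snd p) \<in> \<Omega>" using assms by simp
  obtain K d where Kd: "K > 0" "d > 0" "cball (fst p) d \<times> cball (snd p) d \<subseteq> \<Omega>"
    "\<forall>h\<in>bergman_space \<Omega>. \<forall>x\<in>cball (fst p) d \<times> cball (snd p) d.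
        cmod (h x) \<le> K * sqrt (l2_normsq (lebesgue_on \<Omega>) h)"
    by (rule bergman_local_bound[OF assms(1) p])
  have pin: "p \<in> cball (fst p) d \<times> cball (snd p) d" using Kd(2) by (simp add: mem_Times_iff)
  show thesis
  proof (rule that[of "K\<^sup>2"])
    show "\<forall>h\<in>bergman_space \<Omega>. (cmod (h p))\<^sup>2 \<le> K\<^sup>2 * l2_normsq (lebesgue_on \<Omega>) h"
    proof
      fix h assume h: "h \<in> bergman_space \<Omega>"
      have "cmod (h p) \<le> K * sqrt (l2_normsq (lebesgue_on \<Omega>) h)"
        using Kd(4) h pin by blast
      then have "(cmod (h p))\<^sup>2 \<le> (K * sqrt (l2_normsq (lebesgue_on \<Omega>) h))\<^sup>2" by (intro power_mono) auto
      then show "(cmod (h p))\<^sup>2 \<le> K\<^sup>2 * l2_normsq (lebesgue_on \<Omega>) h" by (simp add: power_mult_distrib)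
    qed
  qed simp
qed

lemma bergman_space_add:
  assumes "g \<in> bergman_space \<Omega>" "h \<in> bergman_space \<Omega>"
  shows "(\<lambda>p. g p + h p) \<in> bergman_space \<Omega>"
proof -
  have "holomorphic2_on (\<lambda>p. g p + h p) \<Omega>"
    unfolding holomorphic2_on_def
  proof
    fix p assume "p \<in> \<Omega>"
    then obtain a b a' b' where
      "(g has_derivative (\<lambda>v. a * fst v + b * snd v)) (at p)"
      "(h has_derivative (\<lambda>v. a' * fst v + b' * snd v)) (at p)"
      using assms unfolding bergman_space_def holomorphic2_on_def by blast
    from has_derivative_add[OF this]
    have "((\<lambda>p. g p + h p) has_derivative (\<lambda>v. (a + a') * fst v + (b + b') * snd v)) (at p)"
      by (simp add: algebra_simps)
    then show "\<exists>a b. ((\<lambda>p. g p + h p) has_derivative (\<lambda>v. a * fst v + b * snd v)) (at p)" by blast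
  qed
  then show ?thesis
    using assms sq_integrable_add by (auto simp: bergman_space_def L2_on_eq)
qed

lemma bergman_space_scale:
  assumes "g \<in> bergman_space \<Omega>"
  shows "(\<lambda>p. c * g p) \<in> bergman_space \<Omega>"
proof -
  have "holomorphic2_on (\<lambda>p. c * g p) \<Omega>"
    unfolding holomorphic2_on_def
  proof
    fix p assume "p \<in> \<Omega>"
    then obtain a b where "(g has_derivative (\<lambda>v. a * fst v + b * snd v)) (at p)"
      using assms unfolding bergman_space_def holomorphic2_on_def by blast
    from has_derivative_mult_right[OF this, of c]
    have "((\<lambda>p. c * g p) has_derivative (\<lambda>v. (c * a) * fst v + (c * b) * snd v)) (at p)"
      by (simp add: algebra_simps)
    then show "\<exists>a b. ((\<lambda>p. c * g p) has_derivative (\<lambda>v. a * fst v + b * snd v)) (at p)" by blast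
  qed
  then show ?thesis
    using assms sq_integrable_scale by (auto simp: bergman_space_def L2_on_eq)
qed

lemma bergman_space_diff:
  assumes "g \<in> bergman_space \<Omega>" "h \<in> bergman_space \<Omega>"
  shows "(\<lambda>p. g p - h p) \<in> bergman_space \<Omega>"
  using bergman_space_add[OF assms(1) bergman_space_scale[OF assms(2), of "-1"]] by simp

lemma bergman_space_zero: "(\<lambda>p. 0) \<in> bergman_space \<Omega>"
proof -
  have "holomorphic2_on (\<lambda>p. 0) \<Omega>"
    unfolding holomorphic2_on_def by (intro ballI exI[of _ 0]) simp
  then show ?thesis by (simp add: bergman_space_def L2_on_def)
qed

lemma bergman_eq_zero:
  assumes "open \<Omega>" "g \<in> bergman_space \<Omega>" "l2_normsq (lebesgue_on \<Omega>) g = 0"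
  shows "g = (\<lambda>p. 0)"
proof
  fix p
  show "g p = 0"
  proof (cases "p \<in> \<Omega>")
    case True
    obtain C where "C \<ge> 0"
      "\<forall>h\<in>bergman_space \<Omega>. (cmod (h p))\<^sup>2 \<le> C * l2_normsq (lebesgue_on \<Omega>) h"
      by (rule bergman_evaluation_bounded[OF assms(1) True])
    from this(2) assms(2,3) show ?thesis by fastforce
  next
    case False
    then show ?thesis using assms(2) unfolding bergman_space_def by blast
  qed
qed

text \<open>
  A Cauchy sequence converges locally uniformly together with its partial derivatives, so the
  pointwise limit is holomorphic. Fatou's lemma shows that it is also the limit in norm.
\<close>

lemma bergman_complete:
  assumes op: "open \<Omega>" and u: "\<And>n. u n \<in> bergman_space \<Omega>"
    and Cau: "\<And>e. e > 0 \<Longrightarrow> \<exists>N. \<forall>m\<ge>N. \<forall>n\<ge>N. l2_normsq (lebesgue_on \<Omega>) (\<lambda>p. u m p - u n p) < e"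
  shows "\<exists>l\<in>bergman_space \<Omega>. (\<lambda>n. l2_normsq (lebesgue_on \<Omega>) (\<lambda>p. u n p - l p)) \<longlonglongrightarrow> 0"
proof -
  let ?M = "lebesgue_on \<Omega>"
  have Cau': "\<exists>N. \<forall>m\<ge>N. \<forall>n\<ge>N. K * sqrt (l2_normsq ?M (\<lambda>p. u m p - u n p)) < e" if "e > 0" "K > 0" for e K
  proof -
    obtain N where N: "\<And>m n. m \<ge> N \<Longrightarrow> n \<ge> N \<Longrightarrow> l2_normsq ?M (\<lambda>p. u m p - u n p) < (e / K)\<^sup>2"
    proof -
      have "(e / K)\<^sup>2 > 0" using \<open>e > 0\<close> \<open>K > 0\<close> by simp
      from Cau[OF this] show thesis using that by blast
    qed
    have "K * sqrt (l2_normsq ?M (\<lambda>p. u m p - u n p)) < e" if "m \<ge> N" "n \<ge> N" for m n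
    proof -
      have "sqrt (l2_normsq ?M (\<lambda>p. u m p - u n p)) < e / K"
        using N[OF that] \<open>e > 0\<close> \<open>K > 0\<close> by (intro real_less_lsqrt) auto
      then show ?thesis using \<open>K > 0\<close> by (simp add: field_simps)
    qed
    then show ?thesis by blast
  qed
  have "\<forall>n. \<forall>x\<in>\<Omega>. \<exists>a b. (u n has_derivative (\<lambda>v. a * fst v + b * snd v)) (at x)"
    using u unfolding bergman_space_def holomorphic2_on_def by blast
  then obtain a b where der:
    "\<And>n x. x \<in> \<Omega> \<Longrightarrow> (u n has_derivative (\<lambda>v. a n x * fst v + b n x * snd v)) (at x)"
    by metis
  have der_diff: "((\<lambda>p. u m p - u n p) has_derivative
      (\<lambda>v. (a m x - a n x) * fst v + (b m x - b n x) * snd v)) (at x)" if "x \<in> \<Omega>" for m n x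
    using has_derivative_diff[OF der[OF that, of m] der[OF that, of n]] by (simp add: algebra_simps)
  \<comment> \<open>near every point the values and both partial derivatives are uniformly Cauchy\<close>
  have unif: "\<exists>d>0. cball (fst p) d \<times> cball (snd p) d \<subseteq> \<Omega> \<and>
      (\<forall>e>0. \<exists>N. \<forall>m\<ge>N. \<forall>n\<ge>N. \<forall>x\<in>cball (fst p) d \<times> cball (snd p) d.
         cmod (u m x - u n x) \<le> e \<and> cmod (a m x - a n x) \<le> e \<and> cmod (b m x - b n x) \<le> e)"
    if "p \<in> \<Omega>" for p
  proof -
    have p: "(fst p, snd p) \<in> \<Omega>" using that by simp
    obtain K d where Kd: "K > 0" "d > 0" "cball (fst p) d \<times> cball (snd p) d \<subseteq> \<Omega>"
      "\<forall>h\<in>bergman_space \<Omega>. \<forall>x\<in>cball (fst p) d \<times> cball (snd p) d.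
          cmod (h x) \<le> K * sqrt (l2_normsq ?M h)"
      "\<forall>h\<in>bergman_space \<Omega>. \<forall>x\<in>cball (fst p) d \<times> cball (snd p) d. \<forall>a b.
          (h has_derivative (\<lambda>v. a * fst v + b * snd v)) (at x) \<longrightarrow>
          cmod a \<le> K * sqrt (l2_normsq ?M h) \<and> cmod b \<le> K * sqrt (l2_normsq ?M h)"
      by (rule bergman_local_bound[OF op p])
    have "\<exists>N. \<forall>m\<ge>N. \<forall>n\<ge>N. \<forall>x\<in>cball (fst p) d \<times> cball (snd p) d.
         cmod (u m x - u n x) \<le> e \<and> cmod (a m x - a n x) \<le> e \<and> cmod (b m x - b n x) \<le> e"
      if e: "e > 0" for e
    proof -
      obtain N where N: "\<And>m n. m \<ge> N \<Longrightarrow> n \<ge> N \<Longrightarrow> K * sqrt (l2_normsq ?M (\<lambda>p. u m p - u n p)) < e"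
        using Cau'[OF e Kd(1)] by blast
      show ?thesis
      proof (intro exI allI impI ballI)
        fix m n x assume mn: "m \<ge> N" "n \<ge> N" and x: "x \<in> cball (fst p) d \<times> cball (snd p) d"
        have x\<Omega>: "x \<in> \<Omega>" using x Kd(3) by blast
        note D = bergman_space_diff[OF u[of m] u[of n]]
        show "cmod (u m x - u n x) \<le> e \<and> cmod (a m x - a n x) \<le> e \<and> cmod (b m x - b n x) \<le> e"
          using N[OF mn] Kd(4)[rule_format, OF D x] Kd(5)[rule_format, OF D x der_diff[OF x\<Omega>]]
          by linarith
      qed
    qed
    then show ?thesis using Kd by blast
  qed
  have conv: "convergent (\<lambda>n. u n x) \<and> convergent (\<lambda>n. a n x) \<and> convergent (\<lambda>n. b n x)" if x: "x \<in> \<Omega>" for x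
  proof -
    obtain d where d: "d > 0" "\<And>e. e > 0 \<Longrightarrow> \<exists>N. \<forall>m\<ge>N. \<forall>n\<ge>N. \<forall>x\<in>cball (fst x) d \<times> cball (snd x) d.
         cmod (u m x - u n x) \<le> e \<and> cmod (a m x - a n x) \<le> e \<and> cmod (b m x - b n x) \<le> e"
      using unif[OF x] by blast
    have xin: "x \<in> cball (fst x) d \<times> cball (snd x) d" using d(1) by (simp add: mem_Times_iff)
    have *: "\<exists>N. \<forall>m\<ge>N. \<forall>n\<ge>N. cmod (u m x - u n x) < e \<and> cmod (a m x - a n x) < e \<and> cmod (b m x - b n x) < e"
      if "e > 0" for e
    proof -
      obtain N where "\<forall>m\<ge>N. \<forall>n\<ge>N. \<forall>x\<in>cball (fst x) d \<times> cball (snd x) d.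
         cmod (u m x - u n x) \<le> e/2 \<and> cmod (a m x - a n x) \<le> e/2 \<and> cmod (b m x - b n x) \<le> e/2"
        using d(2)[OF half_gt_zero[OF \<open>e > 0\<close>]] by blast
      then have "\<forall>m\<ge>N. \<forall>n\<ge>N. cmod (u m x - u n x) \<le> e/2 \<and> cmod (a m x - a n x) \<le> e/2 \<and> cmod (b m x - b n x) \<le> e/2"
        using xin by blast
      moreover have "e / 2 < e" using that by simp
      ultimately show ?thesis by (meson le_less_trans)
    qed
    then show ?thesis
      unfolding Cauchy_convergent_iff[symmetric] Cauchy_iff by meson
  qed
  define l where "l x = (if x \<in> \<Omega> then lim (\<lambda>n. u n x) else 0)" for x
  define A B where "A x = lim (\<lambda>n. a n x)" and "B x = lim (\<lambda>n. b n x)" for x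
  have lim_u: "(\<lambda>n. u n x) \<longlonglongrightarrow> l x" for x
  proof (cases "x \<in> \<Omega>")
    case True
    then show ?thesis using conv[OF True] by (simp add: l_def convergent_LIMSEQ_iff)
  next
    case False
    then have "u n x = 0" for n using u[of n] unfolding bergman_space_def by blast
    then show ?thesis using False by (simp add: l_def)
  qed
  have lim_a: "(\<lambda>n. a n x) \<longlonglongrightarrow> A x" and lim_b: "(\<lambda>n. b n x) \<longlonglongrightarrow> B x" if "x \<in> \<Omega>" for x
    using conv[OF that] by (simp_all add: A_def B_def convergent_LIMSEQ_iff)
  have hol: "holomorphic2_on l \<Omega>"
    unfolding holomorphic2_on_def
  proof
    fix p assume p: "p \<in> \<Omega>"
    obtain d where d: "d > 0" "cball (fst p) d \<times> cball (snd p) d \<subseteq> \<Omega>"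
      "\<And>e. e > 0 \<Longrightarrow> \<exists>N. \<forall>m\<ge>N. \<forall>n\<ge>N. \<forall>x\<in>cball (fst p) d \<times> cball (snd p) d.
         cmod (u m x - u n x) \<le> e \<and> cmod (a m x - a n x) \<le> e \<and> cmod (b m x - b n x) \<le> e"
      using unif[OF p] by blast
    define S where "S = cball (fst p) d \<times> cball (snd p) d"
    have S: "convex S" "S \<subseteq> \<Omega>" "p \<in> S" "p \<in> interior S"
      using d by (auto simp: S_def convex_Times interior_Times mem_Times_iff)
    have "\<exists>g. \<forall>x\<in>S. (\<lambda>n. u n x) \<longlonglongrightarrow> g x \<and>
        (g has_derivative (\<lambda>v. A x * fst v + B x * snd v)) (at x within S)"
    proof (rule has_derivative_sequence[OF S(1) _ _ S(3) lim_u])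
      show "(u n has_derivative (\<lambda>v. a n x * fst v + b n x * snd v)) (at x within S)" if "x \<in> S" for n x
        using der S that has_derivative_at_withinI by blast
      fix e :: real assume e: "e > 0"
      obtain N where N: "\<forall>m\<ge>N. \<forall>n\<ge>N. \<forall>x\<in>S. cmod (u m x - u n x) \<le> e/2 \<and>
          cmod (a m x - a n x) \<le> e/2 \<and> cmod (b m x - b n x) \<le> e/2"
        using d(3)[OF half_gt_zero[OF e]] unfolding S_def by blast
      have "cmod ((a n x * fst v + b n x * snd v) - (A x * fst v + B x * snd v)) \<le> e * norm v"
        if n: "n \<ge> N" and x: "x \<in> S" for n x v
      proof -
        have x\<Omega>: "x \<in> \<Omega>" using x S(2) by blast
        have "cmod (a n x - A x) \<le> e / 2"
        proof (rule LIMSEQ_le_const2)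
          show "(\<lambda>m. cmod (a n x - a m x)) \<longlonglongrightarrow> cmod (a n x - A x)"
            by (intro tendsto_intros lim_a x\<Omega>)
          show "\<exists>N. \<forall>m\<ge>N. cmod (a n x - a m x) \<le> e / 2" using N n x by blast
        qed
        note da = this
        have "cmod (b n x - B x) \<le> e / 2"
        proof (rule LIMSEQ_le_const2)
          show "(\<lambda>m. cmod (b n x - b m x)) \<longlonglongrightarrow> cmod (b n x - B x)"
            by (intro tendsto_intros lim_b x\<Omega>)
          show "\<exists>N. \<forall>m\<ge>N. cmod (b n x - b m x) \<le> e / 2" using N n x by blast
        qed
        note db = this
        have nv: "cmod (fst v) \<le> norm v" "cmod (snd v) \<le> norm v"
          using norm_fst_le[of "fst v" "snd v"] norm_snd_le[of "snd v" "fst v"] by simp_all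
        have "cmod (a n x - A x) * cmod (fst v) \<le> e / 2 * norm v"
          "cmod (b n x - B x) * cmod (snd v) \<le> e / 2 * norm v"
          using e by (intro mult_mono da db nv; simp)+
        moreover have "(a n x * fst v + b n x * snd v) - (A x * fst v + B x * snd v)
            = (a n x - A x) * fst v + (b n x - B x) * snd v" by (simp add: algebra_simps)
        ultimately show ?thesis
          using norm_triangle_ineq[of "(a n x - A x) * fst v" "(b n x - B x) * snd v"]
          by (simp add: norm_mult)
      qed
      then show "\<forall>\<^sub>F n in sequentially. \<forall>x\<in>S. \<forall>v.
          cmod ((a n x * fst v + b n x * snd v) - (A x * fst v + B x * snd v)) \<le> e * norm v"
        unfolding eventually_sequentially by blast
    qed
    then obtain g where g: "\<And>x. x \<in> S \<Longrightarrow> (\<lambda>n. u n x) \<longlonglongrightarrow> g x"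
      "\<And>x. x \<in> S \<Longrightarrow> (g has_derivative (\<lambda>v. A x * fst v + B x * snd v)) (at x within S)" by blast
    have "l x = g x" if "x \<in> S" for x using LIMSEQ_unique[OF lim_u g(1)[OF that]] .
    then have "(l has_derivative (\<lambda>v. A p * fst v + B p * snd v)) (at p within S)"
      using has_derivative_transform[OF S(3) _ g(2)[OF S(3)]] by blast
    then show "\<exists>a b. (l has_derivative (\<lambda>v. a * fst v + b * snd v)) (at p)"
      using at_within_interior[OF S(4)] by auto
  qed
  have sq_u: "u n \<in> sq_integrable ?M" for n using u by (simp add: bergman_space_def L2_on_eq)
  have meas_u [measurable]: "u n \<in> borel_measurable ?M" for n using sq_integrableD(1)[OF sq_u] .
  have meas_l [measurable]: "l \<in> borel_measurable ?M"
    by (rule borel_measurable_LIMSEQ_metric[OF meas_u lim_u])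
  have fatou: "(\<integral>\<^sup>+p. ennreal ((cmod (u n p - l p))\<^sup>2) \<partial>?M) \<le> ennreal e"
    if "\<And>m. m \<ge> N \<Longrightarrow> l2_normsq ?M (\<lambda>p. u n p - u m p) < e" for n N e
  proof -
    have "(\<integral>\<^sup>+p. ennreal ((cmod (u n p - l p))\<^sup>2) \<partial>?M)
        = (\<integral>\<^sup>+p. liminf (\<lambda>m. ennreal ((cmod (u n p - u m p))\<^sup>2)) \<partial>?M)"
    proof (rule nn_integral_cong)
      fix p
      have "(\<lambda>m. ennreal ((cmod (u n p - u m p))\<^sup>2)) \<longlonglongrightarrow> ennreal ((cmod (u n p - l p))\<^sup>2)"
        by (intro tendsto_ennrealI tendsto_intros lim_u)
      then show "ennreal ((cmod (u n p - l p))\<^sup>2) = liminf (\<lambda>m. ennreal ((cmod (u n p - u m p))\<^sup>2))"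
        by (rule lim_imp_Liminf[OF sequentially_bot, symmetric])
    qed
    also have "\<dots> \<le> liminf (\<lambda>m. \<integral>\<^sup>+p. ennreal ((cmod (u n p - u m p))\<^sup>2) \<partial>?M)"
      by (intro nn_integral_liminf) measurable
    also have "\<dots> \<le> limsup (\<lambda>m. \<integral>\<^sup>+p. ennreal ((cmod (u n p - u m p))\<^sup>2) \<partial>?M)"
      by (rule Liminf_le_Limsup) simp
    also have "\<dots> \<le> ennreal e"
    proof (rule Limsup_bounded)
      have "(\<integral>\<^sup>+p. ennreal ((cmod (u n p - u m p))\<^sup>2) \<partial>?M) \<le> ennreal e" if "m \<ge> N" for m
        using nn_integral_eq_l2_normsq[OF sq_integrable_diff[OF sq_u sq_u], of n m] \<open>\<And>m. m \<ge> N \<Longrightarrow> _\<close>[OF that]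
        by (simp add: ennreal_leI)
      then show "\<forall>\<^sub>F m in sequentially. (\<integral>\<^sup>+p. ennreal ((cmod (u n p - u m p))\<^sup>2) \<partial>?M) \<le> ennreal e"
        unfolding eventually_sequentially by blast
    qed
    finally show ?thesis .
  qed
  have close: "(\<lambda>p. u n p - l p) \<in> sq_integrable ?M \<and> l2_normsq ?M (\<lambda>p. u n p - l p) \<le> e"
    if "\<And>m. m \<ge> N \<Longrightarrow> l2_normsq ?M (\<lambda>p. u n p - u m p) < e" "e > 0" for n N e
  proof -
    have F: "(\<integral>\<^sup>+p. ennreal ((cmod (u n p - l p))\<^sup>2) \<partial>?M) \<le> ennreal e"
      by (rule fatou[of N]) (rule that(1))
    have sq: "(\<lambda>p. u n p - l p) \<in> sq_integrable ?M"
      unfolding sq_integrable_iff_nn_integral using le_less_trans[OF F, of \<infinity>] by simp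
    then show ?thesis using F nn_integral_eq_l2_normsq[OF sq] that(2) by simp
  qed
  have "l \<in> sq_integrable ?M"
  proof -
    obtain N where "\<forall>m\<ge>N. \<forall>n\<ge>N. l2_normsq ?M (\<lambda>p. u m p - u n p) < 1" using Cau[of 1] by auto
    then have "(\<lambda>p. u N p - l p) \<in> sq_integrable ?M" using close[of N N 1] by simp
    from sq_integrable_diff[OF sq_u[of N] this] show ?thesis by simp
  qed
  then have "l \<in> bergman_space \<Omega>" using hol by (simp add: bergman_space_def L2_on_eq l_def)
  moreover have "(\<lambda>n. l2_normsq ?M (\<lambda>p. u n p - l p)) \<longlonglongrightarrow> 0"
  proof (rule LIMSEQ_I)
    fix e :: real assume e: "e > 0"
    obtain N where N: "\<forall>m\<ge>N. \<forall>n\<ge>N. l2_normsq ?M (\<lambda>p. u m p - u n p) < e / 2" using Cau[of "e/2"] e by auto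
    have "l2_normsq ?M (\<lambda>p. u n p - l p) \<le> e / 2" if "n \<ge> N" for n
      using close[of N n "e/2"] N e that by simp
    then show "\<exists>N. \<forall>n\<ge>N. norm (l2_normsq ?M (\<lambda>p. u n p - l p) - 0) < e"
      using e by (intro exI[of _ N]) fastforce
  qed
  ultimately show ?thesis by blast
qed

lemma complete_function_space_bergman:
  assumes "open \<Omega>"
  shows "complete_function_space (lebesgue_on \<Omega>) (bergman_space \<Omega>)"
proof
  show "bergman_space \<Omega> \<subseteq> sq_integrable (lebesgue_on \<Omega>)" by (auto simp: bergman_space_def L2_on_eq)
qed (fact bergman_space_add bergman_space_scale bergman_space_zero bergman_complete[OF assms])+

text \<open>
  The projection of \<open>g\<close> represents the functional \<open>h \<mapsto> \<langle>h, g\<rangle>\<close>, so it exists by the Riesz lemma. Two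
  candidates differ by an element of the Bergman space that is orthogonal to itself.
\<close>

lemma bergman_projection_works:
  assumes "open \<Omega>" "g \<in> L2_on \<Omega>"
  shows "bergman_projection \<Omega> g \<in> bergman_space \<Omega>"
    and "\<And>h. h \<in> bergman_space \<Omega> \<Longrightarrow>
      l2_inner (lebesgue_on \<Omega>) (bergman_projection \<Omega> g) h = l2_inner (lebesgue_on \<Omega>) g h"
proof -
  let ?M = "lebesgue_on \<Omega>"
  interpret complete_function_space ?M "bergman_space \<Omega>"
    by (rule complete_function_space_bergman[OF assms(1)])
  have g: "g \<in> sq_integrable ?M" using assms(2) by (simp add: L2_on_eq)
  have "\<exists>u\<in>bergman_space \<Omega>. \<forall>h\<in>bergman_space \<Omega>. l2_inner ?M h g = l2_inner ?M h u"
  proof (rule riesz)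
    show "(cmod (l2_inner ?M h g))\<^sup>2 \<le> l2_normsq ?M g * l2_normsq ?M h" if "h \<in> bergman_space \<Omega>" for h
      using Cauchy_Schwarz_l2_inner[OF sqV[OF that] g] by (simp add: mult.commute)
  qed (use g sqV in \<open>simp_all add: l2_inner_add_left l2_inner_scale_left\<close>)
  then obtain u where u: "u \<in> bergman_space \<Omega>" "\<And>h. h \<in> bergman_space \<Omega> \<Longrightarrow> l2_inner ?M h g = l2_inner ?M h u"
    by blast
  have orth: "(\<forall>h\<in>bergman_space \<Omega>. (LINT p|?M. (g p - v p) * cnj (h p)) = 0) \<longleftrightarrow>
      (\<forall>h\<in>bergman_space \<Omega>. l2_inner ?M v h = l2_inner ?M g h)" if "v \<in> bergman_space \<Omega>" for v
    using l2_inner_diff_left[OF g sqV[OF that] sqV] by (force simp: l2_inner_def)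
  have u': "\<And>h. h \<in> bergman_space \<Omega> \<Longrightarrow> l2_inner ?M u h = l2_inner ?M g h"
    using u(2) by (metis l2_inner_swap)
  have "bergman_projection \<Omega> g = u"
    unfolding bergman_projection_def
  proof (rule the_equality)
    show "u \<in> bergman_space \<Omega> \<and> (\<forall>h\<in>bergman_space \<Omega>. (LINT p|?M. (g p - u p) * cnj (h p)) = 0)"
      using u(1) u' orth by blast
    fix v assume "v \<in> bergman_space \<Omega> \<and> (\<forall>h\<in>bergman_space \<Omega>. (LINT p|?M. (g p - v p) * cnj (h p)) = 0)"
    then have v: "v \<in> bergman_space \<Omega>" "\<And>h. h \<in> bergman_space \<Omega> \<Longrightarrow> l2_inner ?M v h = l2_inner ?M g h"
      using orth by blast+
    let ?d = "\<lambda>p. v p - u p"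
    have d: "?d \<in> bergman_space \<Omega>" by (rule bergman_space_diff[OF v(1) u(1)])
    have "l2_inner ?M ?d ?d = 0"
      using l2_inner_diff_left[OF sqV[OF v(1)] sqV[OF u(1)] sqV[OF d]] v(2)[OF d] u'[OF d] by simp
    then have "l2_normsq ?M ?d = 0" by (simp add: l2_inner_self)
    then have "?d x = 0" for x by (rule fun_cong[OF bergman_eq_zero[OF assms(1) d]])
    then show "v = u" by (intro ext) simp
  qed
  then show "bergman_projection \<Omega> g \<in> bergman_space \<Omega>"
    "\<And>h. h \<in> bergman_space \<Omega> \<Longrightarrow> l2_inner ?M (bergman_projection \<Omega> g) h = l2_inner ?M g h"
    using u(1) u' by auto
qed

text \<open>
  The function \<open>k\<close> represents evaluation at \<open>p\<close>. Its conjugate satisfies the description of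
  the kernel because \<open>g\<close> and its projection have the same inner product with \<open>k\<close>. The description has
  only this solution: applied to the difference of two candidates, which lies in the Bergman space,
  it shows that the difference has norm 0.
\<close>

lemma bergman_kernel_reproducing:
  assumes "open \<Omega>" "p \<in> \<Omega>"
  obtains k where "k \<in> bergman_space \<Omega>"
    "\<And>h. h \<in> bergman_space \<Omega> \<Longrightarrow> h p = l2_inner (lebesgue_on \<Omega>) h k"
    "bergman_kernel \<Omega> p = (\<lambda>q. cnj (k q))"
proof -
  let ?M = "lebesgue_on \<Omega>"
  interpret complete_function_space ?M "bergman_space \<Omega>"
    by (rule complete_function_space_bergman[OF assms(1)])
  have "\<exists>k\<in>bergman_space \<Omega>. \<forall>h\<in>bergman_space \<Omega>. h q = l2_inner ?M h k" if q: "q \<in> \<Omega>" for q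
  proof -
    obtain C where C: "C \<ge> 0"
      "\<forall>h\<in>bergman_space \<Omega>. (cmod (h q))\<^sup>2 \<le> C * l2_normsq (lebesgue_on \<Omega>) h"
      by (rule bergman_evaluation_bounded[OF assms(1) q])
    then show ?thesis by (intro riesz[of "\<lambda>h. h q"]) auto
  qed
  then obtain k where k: "\<And>q. q \<in> \<Omega> \<Longrightarrow> k q \<in> bergman_space \<Omega>"
    "\<And>q h. q \<in> \<Omega> \<Longrightarrow> h \<in> bergman_space \<Omega> \<Longrightarrow> h q = l2_inner ?M h (k q)" by metis
  define K0 where "K0 q = (if q \<in> \<Omega> then (\<lambda>x. cnj (k q x)) else (\<lambda>x. 0))" for q
  have proj: "(LINT x|?M. K q x * g x) = l2_inner ?M g (\<lambda>x. cnj (K q x))" for K :: "complex2 \<Rightarrow> complex2 \<Rightarrow> complex" and q g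
    by (simp add: l2_inner_def mult.commute)
  have "bergman_kernel \<Omega> = K0"
    unfolding bergman_kernel_def
  proof (rule the_equality)
    show "(\<forall>p. p \<notin> \<Omega> \<longrightarrow> K0 p = (\<lambda>q. 0)) \<and> (\<forall>p\<in>\<Omega>. (\<lambda>q. cnj (K0 p q)) \<in> bergman_space \<Omega>) \<and>
        (\<forall>g\<in>L2_on \<Omega>. \<forall>p\<in>\<Omega>. bergman_projection \<Omega> g p = (LINT q|?M. K0 p q * g q))"
    proof (intro conjI allI impI ballI)
      fix g q assume g: "g \<in> L2_on \<Omega>" and q: "q \<in> \<Omega>"
      show "bergman_projection \<Omega> g q = (LINT x|?M. K0 q x * g x)"
        unfolding proj using k(2)[OF q bergman_projection_works(1)[OF assms(1) g]]
          bergman_projection_works(2)[OF assms(1) g k(1)[OF q]] q by (simp add: K0_def)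
    qed (auto simp: K0_def k(1))
  next
    fix K assume K: "(\<forall>p. p \<notin> \<Omega> \<longrightarrow> K p = (\<lambda>q. 0)) \<and> (\<forall>p\<in>\<Omega>. (\<lambda>q. cnj (K p q)) \<in> bergman_space \<Omega>) \<and>
        (\<forall>g\<in>L2_on \<Omega>. \<forall>p\<in>\<Omega>. bergman_projection \<Omega> g p = (LINT q|?M. K p q * g q))"
    show "K = K0"
    proof
      fix q
      show "K q = K0 q"
      proof (cases "q \<in> \<Omega>")
        case True
        let ?k' = "\<lambda>x. cnj (K q x)" and ?d = "\<lambda>x. cnj (K q x) - k q x"
        have k': "?k' \<in> bergman_space \<Omega>" using K True by blast
        have d: "?d \<in> bergman_space \<Omega>" by (rule bergman_space_diff[OF k' k(1)[OF True]])
        then have dL: "?d \<in> L2_on \<Omega>" by (simp add: bergman_space_def)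
        have "bergman_projection \<Omega> ?d q = l2_inner ?M ?d ?k'"
          using K True dL unfolding proj by blast
        moreover have "bergman_projection \<Omega> ?d q = l2_inner ?M ?d (k q)"
          using k(2)[OF True bergman_projection_works(1)[OF assms(1) dL]]
            bergman_projection_works(2)[OF assms(1) dL k(1)[OF True]] by simp
        ultimately have "l2_inner ?M ?d ?d = 0"
          using l2_inner_diff_right[OF sqV[OF k'] sqV[OF k(1)[OF True]] sqV[OF d]] by simp
        then have "l2_normsq ?M ?d = 0" by (simp add: l2_inner_self)
        then have "?d x = 0" for x by (rule fun_cong[OF bergman_eq_zero[OF assms(1) d]])
        then have "K q x = cnj (k q x)" for x by (metis complex_cnj_cnj right_minus_eq)
        then show ?thesis using True by (simp add: K0_def ext)
      next
        case False
        then have "K q = (\<lambda>x. 0)" using K by blast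
        then show ?thesis using False by (simp add: K0_def)
      qed
    qed
  qed
  then show thesis using that[OF k(1)[OF assms(2)] k(2)[OF assms(2)]] assms(2) by (simp add: K0_def)
qed

text \<open>
  The diagonal value is \<open>k p = |k|\<^sup>2\<close>, so it is the supremum of \<open>|h p|\<^sup>2 / |h|\<^sup>2\<close> over the Bergman
  space. The two halves of this extremal property are what the estimates use: a test function bounds the
  kernel from below, a bound on point evaluation bounds it from above.
\<close>

lemma bergman_kernel_diag_lower:
  assumes "open \<Omega>" "p \<in> \<Omega>" "h \<in> bergman_space \<Omega>" "l2_normsq (lebesgue_on \<Omega>) h \<le> c" "c > 0"
  shows "(cmod (h p))\<^sup>2 / c \<le> Re (bergman_kernel \<Omega> p p)"
proof -
  let ?M = "lebesgue_on \<Omega>"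
  obtain k where k: "k \<in> bergman_space \<Omega>" "\<And>h. h \<in> bergman_space \<Omega> \<Longrightarrow> h p = l2_inner ?M h k"
    "bergman_kernel \<Omega> p = (\<lambda>q. cnj (k q))"
    using bergman_kernel_reproducing[OF assms(1,2)] by blast
  have sq: "g \<in> sq_integrable ?M" if "g \<in> bergman_space \<Omega>" for g
    using that by (simp add: bergman_space_def L2_on_eq)
  have "(cmod (h p))\<^sup>2 \<le> l2_normsq ?M h * l2_normsq ?M k"
    unfolding k(2)[OF assms(3)] by (rule Cauchy_Schwarz_l2_inner[OF sq[OF assms(3)] sq[OF k(1)]])
  also have "\<dots> \<le> c * l2_normsq ?M k" by (intro mult_right_mono assms) simp
  also have "l2_normsq ?M k = Re (bergman_kernel \<Omega> p p)" using k(2)[OF k(1)] by (simp add: k(3) l2_inner_self)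
  finally show ?thesis using assms(5) by (simp add: field_simps)
qed

lemma bergman_kernel_diag_upper:
  assumes "open \<Omega>" "p \<in> \<Omega>"
    and bd: "\<And>h. h \<in> bergman_space \<Omega> \<Longrightarrow> (cmod (h p))\<^sup>2 \<le> c * l2_normsq (lebesgue_on \<Omega>) h"
    and "c \<ge> 0"
  shows "Re (bergman_kernel \<Omega> p p) \<le> c"
proof -
  let ?M = "lebesgue_on \<Omega>"
  obtain k where k: "k \<in> bergman_space \<Omega>" "\<And>h. h \<in> bergman_space \<Omega> \<Longrightarrow> h p = l2_inner ?M h k"
    "bergman_kernel \<Omega> p = (\<lambda>q. cnj (k q))"
    using bergman_kernel_reproducing[OF assms(1,2)] by blast
  have kp: "k p = of_real (l2_normsq ?M k)" using k(2)[OF k(1)] by (simp add: l2_inner_self)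
  have "(l2_normsq ?M k)\<^sup>2 \<le> c * l2_normsq ?M k" using bd[OF k(1)] by (simp add: kp)
  then have "l2_normsq ?M k \<le> c"
    using assms(4) l2_normsq_nonneg[of ?M k] by (cases "l2_normsq ?M k = 0") (auto simp: power2_eq_square)
  then show ?thesis by (simp add: k(3) kp)
qed

section \<open>Radial subharmonic functions and flat profiles\<close>

lemma smooth_dir_deriv:
  assumes "smooth g" "b \<in> Basis"
  shows "smooth (dir_deriv b g)"
  unfolding smooth_def
proof
  fix k
  have "cont_diff (Suc k) g" using assms(1) unfolding smooth_def by blast
  then show "cont_diff k (dir_deriv b g)" using assms(2) by simp
qed

lemma smooth_has_derivative:
  assumes "smooth g"
  shows "(g has_derivative frechet_derivative g (at x)) (at x)"
proof -
  have "cont_diff (Suc 0) g" using assms unfolding smooth_def by blast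
  then have "g differentiable at x" by (simp add: differentiable_on_def)
  then show ?thesis by (simp add: frechet_derivative_works)
qed

lemma smooth_continuous_on: "smooth g \<Longrightarrow> continuous_on S g"
  by (metis smooth_def cont_diff.simps(1) continuous_on_subset subset_UNIV)

lemma foldr_dir_deriv_replicate:
  "foldr dir_deriv (replicate n b) g = (dir_deriv b ^^ n) g"
  by (induction n) auto

text \<open>
  Along the line spanned by \<open>b\<close> the function has vanishing Taylor polynomial of every
  order, and the remainder is controlled by a derivative that is bounded on the unit interval.
\<close>

lemma flat_order_bound:
  fixes g :: "'a::euclidean_space \<Rightarrow> real"
  assumes "smooth g" "vanishes_to_infinite_order g 0" "b \<in> Basis"
  shows "\<exists>C>0. \<forall>x\<in>{0..1}. g (x *\<^sub>R b) \<le> C * x ^ n"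
proof -
  define D where "D m t = (dir_deriv b ^^ m) g (t *\<^sub>R b)" for m and t :: real
  have sm: "smooth ((dir_deriv b ^^ m) g)" for m
    by (induction m) (use assms smooth_dir_deriv in auto)
  have deriv: "(D m has_real_derivative D (Suc m) t) (at t)" for m t
  proof -
    let ?g = "(dir_deriv b ^^ m) g"
    have "((\<lambda>t. t *\<^sub>R b) has_derivative (\<lambda>h. h *\<^sub>R b)) (at t)"
      by (auto intro!: derivative_eq_intros)
    from has_derivative_compose[OF this smooth_has_derivative[OF sm]]
    have "(D m has_derivative (\<lambda>h. frechet_derivative ?g (at (t *\<^sub>R b)) (h *\<^sub>R b))) (at t)"
      unfolding D_def .
    moreover have "frechet_derivative ?g (at (t *\<^sub>R b)) (h *\<^sub>R b) = D (Suc m) t * h" for h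
      using linear_scale[OF has_derivative_linear[OF smooth_has_derivative[OF sm]]]
      by (simp add: D_def dir_deriv_def mult.commute)
    ultimately show ?thesis by (simp add: has_field_derivative_def)
  qed
  have zero: "D m 0 = 0" for m
  proof -
    have "foldr dir_deriv (replicate m b) g 0 = 0"
      using assms(2,3) unfolding vanishes_to_infinite_order_def
      by (metis empty_subsetI insert_subset set_replicate_conv_if)
    then show ?thesis by (simp add: D_def foldr_dir_deriv_replicate)
  qed
  have "continuous_on {0..1} (D n)"
    by (meson DERIV_continuous continuous_at_imp_continuous_on deriv)
  then have "bounded (D n ` {0..1})"
    by (intro compact_imp_bounded compact_continuous_image) auto
  then obtain C where C: "C > 0" "\<And>t. t \<in> {0..1} \<Longrightarrow> \<bar>D n t\<bar> \<le> C"
    by (auto simp: bounded_pos)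
  have "g (x *\<^sub>R b) \<le> C * x ^ n" if x: "x \<in> {0..1}" for x
  proof (cases "x = 0 \<or> n = 0")
    case True
    have "D 0 x \<le> C * x ^ n"
    proof (cases "n = 0")
      case True
      then show ?thesis using C(2)[OF x] by auto
    next
      case False
      then show ?thesis using True zero[of 0] C(1) by auto
    qed
    then show ?thesis by (simp add: D_def)
  next
    case False
    have "\<exists>t. 0 < t \<and> t < x \<and>
        D 0 x = (\<Sum>m<n. D m 0 / fact m * x ^ m) + D n t / fact n * x ^ n"
      using False x deriv by (intro Maclaurin) auto
    then obtain t where t: "0 < t" "t < x" "D 0 x = D n t / fact n * x ^ n"
      by (auto simp: zero)
    have "D n t / fact n \<le> \<bar>D n t\<bar> / 1"
      by (intro frac_le) (auto simp: fact_ge_1)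
    also have "\<dots> \<le> C" using C(2)[of t] t x by auto
    finally have "D 0 x \<le> C * x ^ n"
      unfolding t(3) using x by (intro mult_right_mono) auto
    then show ?thesis by (simp add: D_def)
  qed
  then show ?thesis using C(1) by blast
qed

lemma subharmonic_circle_eq_max:
  assumes sub: "subharmonic u" and cont: "continuous_on UNIV u" and "d > 0"
    and le: "\<And>t. u (z + of_real d * cis t) \<le> u z"
    and "t \<in> {0..2*pi}"
  shows "u (z + of_real d * cis t) = u z"
proof -
  define h where "h t = u z - u (z + of_real d * cis t)" for t
  have ch: "continuous_on A (\<lambda>t. u (z + of_real d * cis t))" for A
    by (rule continuous_on_compose2[OF cont]) (auto intro!: continuous_intros)
  then have conth: "continuous_on (cbox 0 (2*pi)) h"
    unfolding h_def by (intro continuous_intros) auto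
  have int: "(\<lambda>t. u (z + of_real d * cis t)) integrable_on {0..2*pi}"
    using ch by (intro integrable_continuous_interval)
  have "u z \<le> 1 / (2*pi) * integral {0..2*pi} (\<lambda>t. u (z + of_real d * cis t))"
    using sub \<open>d > 0\<close> unfolding subharmonic_def by blast
  then have "2 * pi * u z \<le> integral {0..2*pi} (\<lambda>t. u (z + of_real d * cis t))"
    by (simp add: field_simps)
  moreover have "integral {0..2*pi} h
      = integral {0..2*pi} (\<lambda>t. u z) - integral {0..2*pi} (\<lambda>t. u (z + of_real d * cis t))"
    unfolding h_def using int by (intro Henstock_Kurzweil_Integration.integral_diff) auto
  ultimately have "integral {0..2*pi} h \<le> 0" by simp
  moreover have "0 \<le> integral {0..2*pi} h"
    using le conth by (intro Henstock_Kurzweil_Integration.integral_nonneg integrable_continuous_interval)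
      (auto simp: h_def)
  ultimately have "integral (cbox 0 (2*pi)) h = 0" by simp
  then have "\<forall>t\<in>cbox 0 (2*pi). h t = 0"
    using conth le pi_gt_zero by (subst (asm) integral_cbox_eq_0_iff) (auto simp: h_def simp del: pi_gt_zero)
  then show ?thesis using \<open>t \<in> {0..2*pi}\<close> by (simp add: h_def)
qed

text \<open>
  If \<open>f\<close> fails to increase strictly, then its maximum over some interval \<open>[0, r2]\<close> is attained to the
  left of \<open>r2\<close>. Let \<open>a\<close> be the least maximum point. A small circle around \<open>a\<close> contains the point
  \<open>a - d\<close>, and the mean value inequality would make \<open>a - d\<close> a maximum point as well; so \<open>a = 0\<close>.
  Then the circles around 0 show that \<open>F\<close> is constant near 0.
\<close>

lemma radial_subharmonic_strict_mono:
  assumes sub: "subharmonic F" and cont: "continuous_on UNIV F"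
    and rad: "\<And>z. f (cmod z) = F z"
    and nonconst: "\<And>r. r > 0 \<Longrightarrow> \<exists>z. cmod z < r \<and> F z \<noteq> F 0"
  shows "strict_mono_on {0..} f"
proof (rule strict_mono_onI, rule ccontr)
  fix r1 r2 :: real
  assume r: "r1 \<in> {0..}" "r2 \<in> {0..}" "r1 < r2" and neg: "\<not> f r1 < f r2"
  have f_real: "f x = F (of_real x)" if "x \<ge> 0" for x
    using rad[of "of_real x"] that by simp
  have contf: "continuous_on {0..r2} f"
  proof -
    have "continuous_on {0..r2} (\<lambda>x. F (of_real x))"
      by (rule continuous_on_compose2[OF cont]) (auto intro!: continuous_intros)
    then show ?thesis by (rule continuous_on_eq) (auto simp: f_real)
  qed
  obtain m where m: "m \<in> {0..r2}" "\<And>x. x \<in> {0..r2} \<Longrightarrow> f x \<le> f m"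
    using continuous_attains_sup[OF _ _ contf] r by fastforce
  define A where "A = {x \<in> {0..r2}. f x = f m}"
  have "closed A" unfolding A_def
    by (rule continuous_closed_preimage_constant[OF contf]) auto
  then have "compact A" unfolding A_def
    by (metis (no_types, lifting) bounded_closed_interval bounded_subset compact_eq_bounded_closed mem_Collect_eq subsetI)
  moreover have "m \<in> A" using m by (simp add: A_def)
  ultimately obtain a where a: "a \<in> A" "\<And>x. x \<in> A \<Longrightarrow> a \<le> x"
    using compact_attains_inf[of A] by blast
  have "a < r2"
  proof (cases "f r2 = f m")
    case True
    then have "r1 \<in> A" using neg m(2)[of r1] r by (auto simp: A_def)
    then show ?thesis using a(2) r by fastforce
  next
    case False
    then have "a \<noteq> r2" using a(1) by (auto simp: A_def)
    then show ?thesis using a(1) by (auto simp: A_def)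
  qed
  have max: "f x \<le> f a" if "0 \<le> x" "x \<le> r2" for x
    using m(2)[of x] that a(1) by (simp add: A_def)
  have a0: "0 \<le> a" using a(1) by (simp add: A_def)
  have circ: "F (of_real a + of_real d * cis t) = F (of_real a)"
    if "0 < d" "a + d \<le> r2" "t \<in> {0..2*pi}" for d t
  proof (rule subharmonic_circle_eq_max[OF sub cont that(1) _ that(3)])
    fix t
    have "cmod (of_real a + of_real d * cis t) \<le> a + d"
      using norm_triangle_ineq[of "of_real a" "of_real d * cis t"] a0 that by (simp add: norm_mult)
    then show "F (of_real a + of_real d * cis t) \<le> F (of_real a)"
      using max[of "cmod (of_real a + of_real d * cis t)"] that f_real[OF a0]
      by (simp add: rad)
  qed
  have "a = 0"
  proof (rule ccontr)
    assume "a \<noteq> 0"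
    define d where "d = min (a / 2) (r2 - a)"
    have d: "0 < d" "a + d \<le> r2" "d < a"
      using \<open>a \<noteq> 0\<close> a0 \<open>a < r2\<close> by (auto simp: d_def)
    have "F (of_real a + of_real d * cis pi) = F (of_real a)"
      using d by (intro circ) auto
    then have "f (a - d) = f a"
      using d f_real[of "a - d"] f_real[OF a0] by simp
    then have "a - d \<in> A" using a(1) d by (auto simp: A_def)
    then show False using a(2)[of "a - d"] d by simp
  qed
  have "F z = F 0" if "cmod z < r2" for z
  proof (cases "z = 0")
    case False
    have "F (of_real a + of_real (cmod z) * cis 0) = F (of_real a)"
      using False that \<open>a = 0\<close> by (intro circ) auto
    then show ?thesis using \<open>a = 0\<close> rad[of z] rad[of "of_real (cmod z)"] by simp
  qed simp
  moreover have "r2 > 0" using r by simp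
  ultimately show False using nonconst by blast
qed

lemma dir_deriv_cong_open:
  assumes "open U" "p \<in> U" "\<And>q. q \<in> U \<Longrightarrow> g q = h q"
  shows "dir_deriv v g p = dir_deriv v h p"
proof -
  have "(g has_derivative D) (at p) \<longleftrightarrow> (h has_derivative D) (at p)" for D
    using assms by (metis has_derivative_transform_within_open)
  then show ?thesis by (simp add: dir_deriv_def frechet_derivative_def)
qed

lemma dir_deriv_const: "dir_deriv v (\<lambda>_. c) p = 0"
  by (simp add: dir_deriv_def)

lemma dir_deriv_linear:
  assumes "bounded_linear L"
  shows "dir_deriv v L p = L v"
  unfolding dir_deriv_def
  using frechet_derivative_at[OF bounded_linear_imp_has_derivative[OF assms], of p] by simp

text \<open>
  Where \<open>F = 0\<close> the defining function is the real linear function \<open>- Im w\<close>, whose second derivatives vanish.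
\<close>

lemma levi_flat_around_of_locally_zero:
  assumes "r > 0" and zero: "\<And>z. cmod z < r \<Longrightarrow> F z = 0"
  shows "levi_flat_around (graph_domain F) (graph_defining F) (0, 0)"
proof -
  define U :: "complex2 set" where "U = ball 0 r \<times> UNIV"
  have U: "open U" by (simp add: U_def open_Times)
  define L :: "complex2 \<Rightarrow> complex" where "L = (\<lambda>q. - of_real (Im (snd q)))"
  have L: "bounded_linear L"
    unfolding L_def
    by (intro bounded_linear_minus bounded_linear_compose[OF bounded_linear_of_real]
        bounded_linear_compose[OF bounded_linear_Im] bounded_linear_snd)
  have eq: "of_real (graph_defining F q) = L q" if "q \<in> U" for q
    using that zero by (auto simp: U_def graph_defining_def L_def)
  have bar: "wirtinger_bar e (\<lambda>q. of_real (graph_defining F q)) q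
      = (L e + \<i> * L (\<i> * fst e, \<i> * snd e)) / 2" if "q \<in> U" for e q
  proof -
    have "dir_deriv v (\<lambda>q. of_real (graph_defining F q)) q = L v" for v
      using dir_deriv_cong_open[OF U that, of "\<lambda>q. of_real (graph_defining F q)" L v] eq
      by (simp add: dir_deriv_linear[OF L])
    then show ?thesis unfolding wirtinger_bar_def by simp
  qed
  have "wirtinger d (wirtinger_bar e (\<lambda>q. of_real (graph_defining F q))) q = 0"
    if "q \<in> U" for d e q
  proof -
    have "dir_deriv v (wirtinger_bar e (\<lambda>q. of_real (graph_defining F q))) q = 0" for v
      using dir_deriv_cong_open[OF U that, of "wirtinger_bar e (\<lambda>q. of_real (graph_defining F q))"
          "\<lambda>_. (L e + \<i> * L (\<i> * fst e, \<i> * snd e)) / 2" v] bar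
      by (simp add: dir_deriv_const)
    then show ?thesis unfolding wirtinger_def by simp
  qed
  then show ?thesis
    unfolding levi_flat_around_def levi_form_def using U \<open>r > 0\<close>
    by (intro exI[of _ U]) (auto simp: U_def Let_def)
qed

lemma profile_inv:
  assumes "f ` {0..} = {0..}" "t \<ge> 0"
  shows "profile_inv f t \<ge> 0" "f (profile_inv f t) = t"
  using assms inv_into_into[of t f "{0..}"] f_inv_into_f[of t f "{0..}"]
  unfolding profile_inv_def by auto

text \<open>
  The chord from the origin lies above the graph. Convexity is only given on the open interval, so the
  left end point of the chord approaches 0.
\<close>

lemma convex_through_origin:
  fixes \<psi> :: "real \<Rightarrow> real"
  assumes conv: "convex_on {0<..<e} \<psi>" and cont: "continuous_on {0..<e} \<psi>" and "\<psi> 0 = 0"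
    and xy: "0 < x" "x < y" "y < e"
  shows "\<psi> x \<le> x / y * \<psi> y"
proof -
  define a where "a n = x / real (n + 2)" for n
  have a: "0 < a n" "a n < x" for n using xy by (auto simp: a_def field_simps add_pos_nonneg)
  have lim_a: "a \<longlonglongrightarrow> 0"
    unfolding a_def by (intro tendsto_divide_0[OF tendsto_const] filterlim_at_top_imp_at_infinity
        filterlim_compose[OF filterlim_real_sequentially filterlim_add_const_nat_at_top])
  have "(\<lambda>n. \<psi> (a n)) \<longlonglongrightarrow> \<psi> 0"
  proof (rule continuous_on_tendsto_compose[OF cont lim_a])
    show "0 \<in> {0..<e}" using xy by simp
    show "\<forall>\<^sub>F n in sequentially. a n \<in> {0..<e}"
    proof (intro always_eventually allI)
      fix n
      show "a n \<in> {0..<e}" using a[of n] xy by simp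
    qed
  qed
  then have lim_psi: "(\<lambda>n. \<psi> (a n)) \<longlonglongrightarrow> 0" by (simp add: \<open>\<psi> 0 = 0\<close>)
  have le: "\<psi> x \<le> (1 - (x - a n) / (y - a n)) * \<psi> (a n) + (x - a n) / (y - a n) * \<psi> y" for n
  proof -
    define s where "s = (x - a n) / (y - a n)"
    have s: "0 \<le> s" "s \<le> 1" using a[of n] xy by (auto simp: s_def field_simps)
    have "(1 - s) * a n + s * y = a n + s * (y - a n)" by (simp add: algebra_simps)
    also have "\<dots> = x" using a[of n] xy by (simp add: s_def)
    finally show ?thesis
      using convex_onD[OF conv s, of "a n" y] a[of n] xy by (simp add: s_def)
  qed
  have "(\<lambda>n. (1 - (x - a n) / (y - a n)) * \<psi> (a n) + (x - a n) / (y - a n) * \<psi> y)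
      \<longlonglongrightarrow> (1 - (x - 0) / (y - 0)) * 0 + (x - 0) / (y - 0) * \<psi> y"
    using xy by (intro tendsto_intros lim_a lim_psi) auto
  then have "\<psi> x \<le> (1 - (x - 0) / (y - 0)) * 0 + (x - 0) / (y - 0) * \<psi> y"
    using le by (intro LIMSEQ_le_const) auto
  then show ?thesis by simp
qed

text \<open>
  This is the form in which the condition on \<open>\<Lambda>\<close> enters the estimates. Since \<open>\<phi>\<^sup>p\<close> is convex and
  vanishes at 0, the quotient \<open>\<phi>(x)\<^sup>p / x\<close> increases; hence \<open>\<phi> x \<le> l\<^sup>-\<^sup>1\<^sup>/\<^sup>p \<phi> (l x)\<close>, and
  \<open>\<Lambda> x \<le> \<Lambda> (l x) / 2\<close> once \<open>l\<close> is large compared with the constant \<open>B\<close>. As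
  \<open>\<Lambda> = - 1 / ln f\<close>, halving \<open>\<Lambda>\<close> means squaring \<open>f\<close>.
\<close>

lemma Lambda_condition_square_growth:
  assumes mono: "strict_mono_on {0..} f" and surj: "f ` {0..} = {0..}"
    and "f 0 = 0" and "Lambda_condition f"
  shows "\<exists>l>1. \<exists>\<epsilon>>0. \<forall>x. 0 < x \<and> x < \<epsilon> \<longrightarrow> f x \<le> (f (l * x))\<^sup>2"
proof -
  obtain B e \<phi> p where B: "B > 0" and e: "e > 0" "e < profile_inv f 1"
    and cont: "continuous_on {0..e} \<phi>" and p: "p > 0"
    and conv: "convex_on {0<..<e} (\<lambda>x. \<phi> x powr p)"
    and bd: "\<And>x. x \<in> {0..e} \<Longrightarrow> 1 / B * \<phi> x \<le> Lambda f x \<and> Lambda f x \<le> B * \<phi> x"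
    using \<open>Lambda_condition f\<close> unfolding Lambda_condition_def by blast
  have f01: "0 < f x" "f x < 1" if "0 < x" "x \<le> e" for x
    using strict_mono_onD[OF mono, of 0 x] strict_mono_onD[OF mono, of x "profile_inv f 1"]
      profile_inv[OF surj, of 1] that e \<open>f 0 = 0\<close> by auto
  have phi0: "\<phi> 0 = 0"
  proof -
    have "1 / B * \<phi> 0 \<le> 0 \<and> 0 \<le> B * \<phi> 0" using bd[of 0] e by (simp add: Lambda_def)
    then show ?thesis using B by (simp add: zero_le_mult_iff divide_le_0_iff)
  qed
  have Lpos: "0 < Lambda f x" if "0 < x" "x \<le> e" for x
    using f01[OF that] that by (simp add: Lambda_def divide_neg_neg)
  have phi_pos: "0 < \<phi> x" if "0 < x" "x \<le> e" for x
  proof -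
    have "Lambda f x \<le> B * \<phi> x" using bd[of x] that by simp
    then have "0 < B * \<phi> x" using Lpos[OF that] by linarith
    then show ?thesis using B by (simp add: zero_less_mult_iff)
  qed
  have phi_nonneg: "0 \<le> \<phi> x" if "x \<in> {0..e}" for x
    using phi_pos[of x] phi0 that by (cases "x = 0") auto
  have "continuous_on {0..<e} \<phi>" by (rule continuous_on_subset[OF cont]) auto
  then have "continuous_on {0..<e} (\<lambda>x. \<phi> x powr p)"
    using phi_nonneg p by (intro continuous_on_powr') (auto intro: continuous_on_const)
  then have psi: "\<phi> x powr p \<le> x / y * \<phi> y powr p" if "0 < x" "x < y" "y < e" for x y
    using convex_through_origin[OF conv _ _ that] phi0 by simp
  \<comment> \<open>chosen such that \<open>l powr (1 / p)\<close> exceeds \<open>2 * B\<^sup>2\<close>, where one \<open>B\<close> is lost at \<open>x\<close> and one at \<open>l * x\<close>\<close>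
  define l where "l = max 2 ((2 * B\<^sup>2) powr p)"
  have l: "l \<ge> 2" by (simp add: l_def)
  have "2 * B\<^sup>2 = ((2 * B\<^sup>2) powr p) powr (1 / p)"
    using p B by (simp add: powr_powr)
  also have "\<dots> \<le> l powr (1 / p)"
    using p by (intro powr_mono2) (auto simp: l_def)
  finally have lB: "2 * B\<^sup>2 \<le> l powr (1 / p)" .
  have "f x \<le> (f (l * x))\<^sup>2" if x: "0 < x" "x < e / l" for x
  proof -
    define y where "y = l * x"
    have y: "0 < x" "x < y" "y < e" using x l by (auto simp: y_def field_simps)
    have "\<phi> x = (\<phi> x powr p) powr (1 / p)"
      using p phi_pos[of x] y by (simp add: powr_powr)
    also have "\<dots> \<le> (x / y * \<phi> y powr p) powr (1 / p)"
      using p by (intro powr_mono2 psi y) auto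
    also have "\<dots> = (1 / l) powr (1 / p) * \<phi> y"
    proof -
      have "x / y = 1 / l" using l x by (simp add: y_def)
      then show ?thesis using p phi_pos[of y] y l by (simp only: powr_mult powr_powr) simp
    qed
    also have "(1 / l) powr (1 / p) = 1 / l powr (1 / p)"
      using l by (simp add: powr_divide)
    also have "1 / l powr (1 / p) * \<phi> y \<le> 1 / (2 * B\<^sup>2) * \<phi> y"
      using lB B phi_pos[of y] y by (intro mult_right_mono frac_le) auto
    finally have "B * \<phi> x \<le> 1 / 2 * (1 / B * \<phi> y)"
      using B by (simp add: field_simps power2_eq_square)
    then have "Lambda f x \<le> 1 / 2 * Lambda f y"
      using bd[of x, THEN conjunct2] bd[of y, THEN conjunct1] y by simp
    then have "1 / (- ln (f x)) \<le> 1 / (2 * - ln (f y))"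
      using y by (simp add: Lambda_def)
    moreover have "- ln (f x) > 0" "- ln (f y) > 0"
      using f01[of x] f01[of y] y by auto
    ultimately have "2 * - ln (f y) \<le> - ln (f x)"
      by (simp add: field_simps)
    then have "ln (f x) \<le> ln ((f y)\<^sup>2)"
      using f01[of y] y by (simp add: ln_realpow)
    then show ?thesis using f01[of x] f01[of y] y by (simp add: y_def)
  qed
  then show ?thesis using l e by (intro exI[of _ l] conjI exI[of _ "e / l"]) auto
qed

section \<open>Kernel estimates on domains above a graph\<close>

lemma nn_integral_cball_const:
  assumes "r \<ge> 0"
  shows "(\<integral>\<^sup>+z. indicator (cball (a::complex) r) z * c \<partial>lborel) = ennreal (pi * r\<^sup>2) * c"
proof -
  have "(\<integral>\<^sup>+z. indicator (cball a r) z * c \<partial>lborel) = (\<integral>\<^sup>+z. indicator (cball a r) z \<partial>lborel) * c"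
    by (rule nn_integral_multc) (auto intro!: borel_measurable_indicator)
  then show ?thesis using assms by (simp add: emeasure_cball_complex)
qed

lemma dyadic_shell:
  fixes x a :: real
  assumes "0 < a" "a \<le> x"
  shows "\<exists>j. 2 ^ j * a \<le> x \<and> x \<le> 2 ^ Suc j * a"
proof -
  obtain n where "x / a < 2 ^ n" using real_arch_pow[of 2 "x / a"] by auto
  then have ex: "\<exists>n. x \<le> 2 ^ Suc n * a"
    using assms by (intro exI[of _ n]) (auto simp: field_simps)
  define j where "j = (LEAST n. x \<le> 2 ^ Suc n * a)"
  have "x \<le> 2 ^ Suc j * a" unfolding j_def using ex by (rule LeastI_ex)
  moreover have "2 ^ j * a \<le> x"
  proof (cases j)
    case (Suc i)
    then have "\<not> x \<le> 2 ^ Suc i * a"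
      unfolding j_def using not_less_Least[of i "\<lambda>n. x \<le> 2 ^ Suc n * a"] by simp
    then show ?thesis by (simp add: Suc)
  qed (use assms in simp)
  ultimately show ?thesis by blast
qed

text \<open>
  Sum over the dyadic shells \<open>2\<^sup>j a \<le> |u| \<le> 2\<^sup>j\<^sup>+\<^sup>1 a\<close>: their contributions form a geometric series of ratio 1/4.
\<close>

lemma nn_integral_inverse_fourth_tail:
  assumes "a > 0"
  shows "(\<integral>\<^sup>+u. indicator {u. a \<le> cmod u} u * ennreal (1 / cmod u ^ 4) \<partial>lborel)
      \<le> ennreal (16 * pi / (3 * a\<^sup>2))"
proof -
  let ?g = "\<lambda>j u. indicator (cball (0::complex) (2 ^ Suc j * a)) u * ennreal (1 / (2 ^ j * a) ^ 4)"
  have pt: "indicator {u. a \<le> cmod u} u * ennreal (1 / cmod u ^ 4) \<le> (\<Sum>j. ?g j u)" for u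
  proof (cases "a \<le> cmod u")
    case True
    obtain j where j: "2 ^ j * a \<le> cmod u" "cmod u \<le> 2 ^ Suc j * a"
      using dyadic_shell[OF assms True] by blast
    have "0 < 2 ^ j * a" using assms by simp
    moreover have "0 < cmod u" using assms True by linarith
    ultimately have "1 / cmod u ^ 4 \<le> 1 / (2 ^ j * a) ^ 4"
      using j(1) assms by (intro frac_le power_mono zero_less_power) simp_all
    then have "indicator {u. a \<le> cmod u} u * ennreal (1 / cmod u ^ 4) \<le> ?g j u"
      using j(2) True by (simp add: ennreal_leI del: power_Suc)
    also have "\<dots> \<le> (\<Sum>j. ?g j u)"
    proof -
      have "x j \<le> suminf x" for x :: "nat \<Rightarrow> ennreal"
        using sum_le_suminf[of x "{j}"] by simp
      then show ?thesis .
    qed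
    finally show ?thesis .
  qed simp
  have shell: "(\<integral>\<^sup>+u. ?g j u \<partial>lborel) = ennreal (4 * pi / a\<^sup>2 * (1 / 4) ^ j)" for j
  proof -
    have "(\<integral>\<^sup>+u. ?g j u \<partial>lborel) = ennreal (pi * (2 ^ Suc j * a)\<^sup>2) * ennreal (1 / (2 ^ j * a) ^ 4)"
      by (rule nn_integral_cball_const) (use assms in simp)
    also have "\<dots> = ennreal (pi * (2 ^ Suc j * a)\<^sup>2 * (1 / (2 ^ j * a) ^ 4))"
      by (rule ennreal_mult'[symmetric]) simp
    also have "pi * (2 ^ Suc j * a)\<^sup>2 * (1 / (2 ^ j * a) ^ 4) = 4 * pi / a\<^sup>2 * (1 / 2 ^ j)\<^sup>2"
      using assms by (simp add: field_simps power2_eq_square power4_eq_xxxx)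
    also have "(1 / 2 ^ j)\<^sup>2 = (1 / 4 :: real) ^ j"
    proof -
      have "(1 / 2 ^ j)\<^sup>2 = (((1 / 2 :: real)\<^sup>2) ^ j)"
        by (simp only: power_one_over[symmetric] power_mult[symmetric] mult.commute)
      then show ?thesis by (simp add: power2_eq_square)
    qed
    finally show ?thesis .
  qed
  have sums: "(\<lambda>j. 4 * pi / a\<^sup>2 * (1 / 4) ^ j) sums (4 * pi / a\<^sup>2 * (1 / (1 - 1 / 4)))"
    by (intro sums_mult geometric_sums) simp
  have "(\<integral>\<^sup>+u. indicator {u. a \<le> cmod u} u * ennreal (1 / cmod u ^ 4) \<partial>lborel)
      \<le> (\<integral>\<^sup>+u. (\<Sum>j. ?g j u) \<partial>lborel)"
    by (intro nn_integral_mono pt)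
  also have "\<dots> = (\<Sum>j. \<integral>\<^sup>+u. ?g j u \<partial>lborel)"
    by (intro nn_integral_suminf borel_measurable_times_ennreal borel_measurable_indicator
        borel_measurable_const) simp
  also have "\<dots> = (\<Sum>j. ennreal (4 * pi / a\<^sup>2 * (1 / 4) ^ j))" by (simp only: shell)
  also have "\<dots> = ennreal (4 * pi / a\<^sup>2 * (1 / (1 - 1 / 4)))"
    by (rule suminf_ennreal_eq[OF _ sums]) (simp add: zero_le_divide_iff)
  also have "4 * pi / a\<^sup>2 * (1 / (1 - 1 / 4)) = 16 * pi / (3 * a\<^sup>2)" by simp
  finally show ?thesis .
qed

text \<open>
  After translation by \<open>- x0 + \<i> t\<close> the half-plane lies outside the disc of radius \<open>a = t + b\<close> around 0. There
  all but four powers of the integrand are bounded by \<open>a\<close>, and the fourth power is integrable.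
\<close>

lemma nn_integral_half_plane:
  assumes "b \<ge> 0" "t > 0"
  shows "(\<integral>\<^sup>+w. indicator {w. Im w > b} w * ennreal (1 / cmod (w - of_real x0 + \<i> * of_real t) ^ (2 * m + 4)) \<partial>lborel)
      \<le> ennreal (16 * pi / 3 * (1 / (t + b)) ^ (2 * m + 2))"
proof -
  define a where "a = t + b"
  define c where "c = - of_real x0 + \<i> * of_real t"
  have a: "a > 0" using assms by (simp add: a_def)
  let ?g = "\<lambda>u. indicator {u. a \<le> cmod u} u * ennreal (1 / cmod u ^ 4)"
  have meas: "?g \<in> borel_measurable borel" by measurable
  have pt: "indicator {w. Im w > b} w * ennreal (1 / cmod (w - of_real x0 + \<i> * of_real t) ^ (2 * m + 4))
      \<le> ennreal ((1 / a) ^ (2 * m)) * ?g (c + w)" for w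
  proof (cases "Im w > b")
    case True
    have eq: "w - of_real x0 + \<i> * of_real t = c + w" by (simp add: c_def)
    have "a \<le> Im (c + w)" using True by (simp add: a_def c_def)
    also have "\<dots> \<le> cmod (c + w)" using abs_Im_le_cmod[of "c + w"] by linarith
    finally have le: "a \<le> cmod (c + w)" .
    have "1 / cmod (c + w) ^ (2 * m + 4) = (1 / cmod (c + w)) ^ (2 * m) * (1 / cmod (c + w) ^ 4)"
      by (simp add: power_add power_one_over field_simps)
    also have "\<dots> \<le> (1 / a) ^ (2 * m) * (1 / cmod (c + w) ^ 4)"
      using le a by (intro mult_right_mono power_mono divide_left_mono mult_pos_pos) auto
    finally show ?thesis
      using True le a unfolding eq by (simp add: ennreal_mult'[symmetric] ennreal_leI)
  qed simp
  have "(\<integral>\<^sup>+w. indicator {w. Im w > b} w * ennreal (1 / cmod (w - of_real x0 + \<i> * of_real t) ^ (2 * m + 4)) \<partial>lborel)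
      \<le> (\<integral>\<^sup>+w. ennreal ((1 / a) ^ (2 * m)) * ?g (c + w) \<partial>lborel)"
    by (intro nn_integral_mono pt)
  also have "\<dots> = ennreal ((1 / a) ^ (2 * m)) * (\<integral>\<^sup>+w. ?g (c + w) \<partial>lborel)"
    by (rule nn_integral_cmult) measurable
  also have "(\<integral>\<^sup>+w. ?g (c + w) \<partial>lborel) = (\<integral>\<^sup>+w. ?g w \<partial>lborel)"
    by (rule nn_integral_translate[OF meas])
  also have "ennreal ((1 / a) ^ (2 * m)) * (\<integral>\<^sup>+w. ?g w \<partial>lborel)
      \<le> ennreal ((1 / a) ^ (2 * m)) * ennreal (16 * pi / (3 * a\<^sup>2))"
    by (intro mult_left_mono nn_integral_inverse_fourth_tail a) simp
  also have "\<dots> = ennreal ((1 / a) ^ (2 * m) * (16 * pi / (3 * a\<^sup>2)))"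
    by (rule ennreal_mult'[symmetric]) (use a in simp)
  also have "(1 / a) ^ (2 * m) * (16 * pi / (3 * a\<^sup>2)) = 16 * pi / 3 * (1 / a) ^ (2 * m + 2)"
    using a by (simp add: power_add field_simps power2_eq_square)
  finally show ?thesis by (simp add: a_def)
qed

lemma open_graph_domain:
  assumes "continuous_on UNIV F"
  shows "open (graph_domain F)"
proof -
  have "graph_domain F = {p. F (fst p) < Im (snd p)}" by (auto simp: graph_domain_def)
  moreover have "open {p :: complex2. F (fst p) < Im (snd p)}"
    by (intro open_Collect_less continuous_on_compose2[OF assms] continuous_intros) auto
  ultimately show ?thesis by simp
qed

lemma bergman_spaceI:
  assumes "open \<Omega>" "holomorphic2_on h \<Omega>" "\<And>p. p \<notin> \<Omega> \<Longrightarrow> h p = 0"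
    and bd: "(\<integral>\<^sup>+p. indicator \<Omega> p * ennreal ((cmod (h p))\<^sup>2) \<partial>lborel) \<le> ennreal c" and "c \<ge> 0"
  shows "h \<in> bergman_space \<Omega>" "l2_normsq (lebesgue_on \<Omega>) h \<le> c"
proof -
  have "h \<in> borel_measurable (lebesgue_on \<Omega>)"
    using assms(1) holomorphic2_continuous_on[OF assms(2)]
    by (intro continuous_imp_measurable_on_sets_lebesgue) auto
  moreover have le: "(\<integral>\<^sup>+p. ennreal ((cmod (h p))\<^sup>2) \<partial>lebesgue_on \<Omega>) \<le> ennreal c"
    using bd by (simp add: nn_integral_lebesgue_on_open[OF assms(1)] mult.commute)
  ultimately have sq: "h \<in> sq_integrable (lebesgue_on \<Omega>)"
    unfolding sq_integrable_iff_nn_integral using le_less_trans[OF le, of \<infinity>] by simp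
  show "l2_normsq (lebesgue_on \<Omega>) h \<le> c"
    using le nn_integral_eq_l2_normsq[OF sq] \<open>c \<ge> 0\<close> by simp
  show "h \<in> bergman_space \<Omega>"
    using sq assms(2,3) unfolding bergman_space_def L2_on_eq by blast
qed

lemma holomorphic2_on_snd:
  assumes "open \<Omega>" and g: "g holomorphic_on W" and "open W" and sub: "\<And>p. p \<in> \<Omega> \<Longrightarrow> snd p \<in> W"
  shows "holomorphic2_on (\<lambda>p. if p \<in> \<Omega> then g (snd p) else 0) \<Omega>"
  unfolding holomorphic2_on_def
proof
  fix p assume p: "p \<in> \<Omega>"
  obtain D where "(g has_field_derivative D) (at (snd p))"
    using g sub[OF p] holomorphic_on_open[OF \<open>open W\<close>] by blast
  then have "(g has_derivative (\<lambda>v. D * v)) (at (snd p))" by (simp add: has_field_derivative_def)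
  from has_derivative_compose[OF has_derivative_snd[OF has_derivative_ident] this]
  have "((\<lambda>p. g (snd p)) has_derivative (\<lambda>v. 0 * fst v + D * snd v)) (at p)" by simp
  then have "((\<lambda>p. if p \<in> \<Omega> then g (snd p) else 0) has_derivative (\<lambda>v. 0 * fst v + D * snd v)) (at p)"
    by (rule has_derivative_transform_within_open[OF _ assms(1) p]) simp
  then show "\<exists>a b. ((\<lambda>p. if p \<in> \<Omega> then g (snd p) else 0) has_derivative (\<lambda>v. a * fst v + b * snd v)) (at p)"
    by blast
qed

text \<open>
  The test function is \<open>h (z, w) = (w - Re w0 + \<i> t)\<^sup>-\<^sup>m\<^sup>-\<^sup>2\<close> with \<open>t = Im w0\<close>. Its pole in \<open>w\<close> is
  the point \<open>Re w0 - \<i> t\<close>, the mirror image of \<open>w0\<close>; its modulus at \<open>(z0, w0)\<close> is \<open>(2 t)\<^sup>-\<^sup>m\<^sup>-\<^sup>2\<close>, and integrating out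
  \<open>w\<close> leaves the weight \<open>(t + F z)\<^sup>-\<^sup>2\<^sup>m\<^sup>-\<^sup>2\<close>.
\<close>

lemma diag_kernel_lower_of_weight:
  assumes cont: "continuous_on UNIV F" and nonneg: "\<And>z. F z \<ge> 0"
    and p: "(z0, w0) \<in> graph_domain F"
    and weight: "(\<integral>\<^sup>+z. ennreal ((1 / (Im w0 + F z)) ^ (2 * m + 2)) \<partial>lborel) \<le> ennreal I" and "I > 0"
  shows "(1 / (2 * Im w0)) ^ (2 * m + 4) / (16 * pi / 3 * I) \<le> diag_kernel F z0 w0"
proof -
  let ?\<Omega> = "graph_domain F"
  define t where "t = Im w0"
  have t: "t > 0" using p nonneg[of z0] by (simp add: graph_domain_def t_def)
  have op: "open ?\<Omega>" by (rule open_graph_domain[OF cont])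
  define g where "g w = 1 / (w - of_real (Re w0) + \<i> * of_real t) ^ (m + 2)" for w
  define h where "h p = (if p \<in> ?\<Omega> then g (snd p) else 0)" for p
  let ?W = "{w. Im w > 0}"
  have nz: "w - of_real (Re w0) + \<i> * of_real t \<noteq> 0" if "Im w > 0" for w
    using that t by (auto simp: complex_eq_iff)
  have W: "snd p \<in> ?W" if "p \<in> ?\<Omega>" for p
    using that nonneg[of "fst p"] by (cases p) (auto simp: graph_domain_def)
  have "g holomorphic_on ?W"
    unfolding g_def using nz by (auto intro!: holomorphic_intros)
  then have hol: "holomorphic2_on h ?\<Omega>"
    unfolding h_def[abs_def] by (rule holomorphic2_on_snd[OF op _ open_halfspace_Im_gt W])
  have g_sq: "(cmod (g w))\<^sup>2 = 1 / cmod (w - of_real (Re w0) + \<i> * of_real t) ^ (2 * m + 4)" for w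
  proof -
    have "(cmod (1 / X ^ (m + 2)))\<^sup>2 = 1 / cmod X ^ (2 * m + 4)" for X :: complex
    proof -
      have "(m + 2) * 2 = 2 * m + 4" by simp
      then show ?thesis
        by (simp only: norm_divide norm_one norm_power power_divide power_one power_mult[symmetric])
    qed
    then show ?thesis by (simp only: g_def)
  qed
  let ?H = "\<lambda>p. indicator ?\<Omega> p * ennreal ((cmod (h p))\<^sup>2)"
  have "(\<lambda>p. indicator ?\<Omega> p *\<^sub>R (cmod (h p))\<^sup>2) \<in> borel_measurable borel"
    using op by (intro borel_measurable_continuous_on_indicator continuous_on_power continuous_on_norm
        holomorphic2_continuous_on[OF hol]) auto
  then have H [measurable]: "?H \<in> borel_measurable (lborel \<Otimes>\<^sub>M lborel)"
    by (simp add: lborel_prod ennreal_indicator[symmetric] flip: ennreal_mult')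
  have slice: "?H (z, w) = indicator {w. Im w > F z} w *
      ennreal (1 / cmod (w - of_real (Re w0) + \<i> * of_real t) ^ (2 * m + 4))" for z w
    by (auto simp: h_def g_sq[symmetric] graph_domain_def indicator_def)
  have "(\<integral>\<^sup>+p. ?H p \<partial>lborel) = (\<integral>\<^sup>+z. \<integral>\<^sup>+w. ?H (z, w) \<partial>lborel \<partial>lborel)"
    by (subst lborel.nn_integral_fst[OF H]) (simp add: lborel_prod)
  also have "\<dots> \<le> (\<integral>\<^sup>+z. ennreal (16 * pi / 3 * (1 / (t + F z)) ^ (2 * m + 2)) \<partial>lborel)"
    unfolding slice by (intro nn_integral_mono nn_integral_half_plane nonneg t)
  also have "\<dots> = (\<integral>\<^sup>+z. ennreal (16 * pi / 3) * ennreal ((1 / (t + F z)) ^ (2 * m + 2)) \<partial>lborel)"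
    using nonneg t by (intro nn_integral_cong ennreal_mult) (auto simp: add_nonneg_nonneg less_imp_le)
  also have "\<dots> = ennreal (16 * pi / 3) * (\<integral>\<^sup>+z. ennreal ((1 / (t + F z)) ^ (2 * m + 2)) \<partial>lborel)"
  proof (rule nn_integral_cmult)
    have [measurable]: "F \<in> borel_measurable borel" by (rule borel_measurable_continuous_onI[OF cont])
    show "(\<lambda>z. ennreal ((1 / (t + F z)) ^ (2 * m + 2))) \<in> borel_measurable lborel" by measurable
  qed
  also have "\<dots> \<le> ennreal (16 * pi / 3) * ennreal I"
    using weight by (intro mult_left_mono) (auto simp: t_def)
  also have "\<dots> = ennreal (16 * pi / 3 * I)" by (rule ennreal_mult'[symmetric]) simp
  finally have bd: "(\<integral>\<^sup>+p. ?H p \<partial>lborel) \<le> ennreal (16 * pi / 3 * I)" .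
  have pos: "16 * pi / 3 * I > 0" using \<open>I > 0\<close> by simp
  have zero: "h p = 0" if "p \<notin> ?\<Omega>" for p using that by (simp add: h_def)
  have "w0 - of_real (Re w0) + \<i> * of_real t = 2 * \<i> * of_real t" by (simp add: complex_eq_iff t_def)
  then have "(cmod (h (z0, w0)))\<^sup>2 = (1 / (2 * t)) ^ (2 * m + 4)"
    using p t by (simp add: h_def g_sq norm_mult power_one_over)
  then show ?thesis
    using bergman_kernel_diag_lower[OF op p bergman_spaceI(1)[OF op hol zero bd less_imp_le[OF pos]]
        bergman_spaceI(2)[OF op hol zero bd less_imp_le[OF pos]] pos]
    by (simp add: diag_kernel_def t_def)
qed

lemma diag_kernel_upper_of_polydisc:
  assumes cont: "continuous_on UNIV F" and "\<rho> > 0" "\<tau> > 0"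
    and small: "\<And>z. cmod z \<le> 2 * \<rho> \<Longrightarrow> F z < \<tau> / 2"
    and z0: "cmod z0 \<le> \<rho>" and w0: "Im w0 = \<tau>"
  shows "diag_kernel F z0 w0 \<le> 4 / (pi\<^sup>2 * \<rho>\<^sup>2 * \<tau>\<^sup>2)"
  unfolding diag_kernel_def
proof (rule bergman_kernel_diag_upper)
  show op: "open (graph_domain F)" by (rule open_graph_domain[OF cont])
  have sub: "cball z0 \<rho> \<times> cball w0 (\<tau> / 2) \<subseteq> graph_domain F"
  proof clarify
    fix z w assume zw: "z \<in> cball z0 \<rho>" "w \<in> cball w0 (\<tau> / 2)"
    have "cmod z \<le> 2 * \<rho>"
      using zw(1) z0 norm_triangle_ineq4[of z0 "z0 - z"] by (simp add: dist_norm)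
    moreover
    have "\<bar>Im (w0 - w)\<bar> \<le> \<tau> / 2"
      using zw(2) abs_Im_le_cmod[of "w0 - w"] by (simp add: dist_norm)
    then have "Im w0 - Im w \<le> \<tau> / 2" using abs_ge_self[of "Im (w0 - w)"] by simp
    then have "\<tau> / 2 \<le> Im w" using w0 by linarith
    ultimately show "(z, w) \<in> graph_domain F"
      using small[of z] by (simp add: graph_domain_def)
  qed
  show "(z0, w0) \<in> graph_domain F" using sub assms by auto
  fix h assume "h \<in> bergman_space (graph_domain F)"
  from bergman_point_bound[OF op this _ _ sub] assms
  have "(cmod (h (z0, w0)))\<^sup>2 * (pi * \<rho>\<^sup>2 * (pi * (\<tau> / 2)\<^sup>2)) \<le> l2_normsq (lebesgue_on (graph_domain F)) h"
    by simp
  moreover have "pi * \<rho>\<^sup>2 * (pi * (\<tau> / 2)\<^sup>2) > 0" using assms by simp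
  ultimately have "(cmod (h (z0, w0)))\<^sup>2 \<le> l2_normsq (lebesgue_on (graph_domain F)) h / (pi * \<rho>\<^sup>2 * (pi * (\<tau> / 2)\<^sup>2))"
    by (simp only: pos_le_divide_eq)
  also have "\<dots> = 4 / (pi\<^sup>2 * \<rho>\<^sup>2 * \<tau>\<^sup>2) * l2_normsq (lebesgue_on (graph_domain F)) h"
    using assms by (simp add: field_simps power2_eq_square)
  finally show "(cmod (h (z0, w0)))\<^sup>2 \<le> 4 / (pi\<^sup>2 * \<rho>\<^sup>2 * \<tau>\<^sup>2) * l2_normsq (lebesgue_on (graph_domain F)) h" .
qed (use assms in auto)

text \<open>
  The plane is covered by three pieces: the disc of radius \<open>\<sigma>\<close>, where the integrand is at most \<open>t\<^sup>-\<^sup>q\<close> with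
  \<open>q = 2 m + 2\<close>; the disc of radius \<open>R\<close>, where outside the first one \<open>F \<ge> sqrt t\<close> gives \<open>t\<^sup>-\<^sup>q\<^sup>/\<^sup>2\<close>; and the
  complement of the latter, where the growth of \<open>F\<close> gives a multiple of \<open>|z|\<^sup>-\<^sup>4\<close>. Compared with
  \<open>t\<^sup>-\<^sup>q\<close> the last two are smaller by at least a factor \<open>t\<close>.
\<close>

lemma radial_weight_integral:
  fixes F :: "complex \<Rightarrow> real" and \<eta> R C :: real
  assumes cont: "continuous_on UNIV F" and nonneg: "\<And>z. F z \<ge> 0"
    and t: "0 < t" "t \<le> 1" and \<sigma>: "\<sigma> > 0"
    and big: "\<And>z. cmod z > \<sigma> \<Longrightarrow> sqrt t \<le> F z"
    and R: "R \<ge> 1" and C: "C > 0"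
    and growth: "\<And>z. cmod z \<ge> R \<Longrightarrow> F z \<ge> C * cmod z powr \<eta>"
    and m: "\<eta> * real (2 * m + 2) \<ge> 4"
  shows "(\<integral>\<^sup>+z. ennreal ((1 / (t + F z)) ^ (2 * m + 2)) \<partial>lborel)
      \<le> ennreal ((pi * \<sigma>\<^sup>2 + t * (pi * R\<^sup>2 + 16 * pi / 3 * (1 / C) ^ (2 * m + 2))) / t ^ (2 * m + 2))"
proof -
  let ?q = "2 * m + 2"
  let ?g = "\<lambda>z. indicator (cball 0 \<sigma>) z * ennreal ((1 / t) ^ ?q)
      + indicator (cball 0 R) z * ennreal ((1 / t) ^ (m + 1))
      + ennreal ((1 / C) ^ ?q) * (indicator {u. R \<le> cmod u} z * ennreal (1 / cmod z ^ 4))"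
  have pt: "ennreal ((1 / (t + F z)) ^ ?q) \<le> ?g z" for z
  proof -
    consider "cmod z \<le> \<sigma>" | "cmod z > \<sigma>" "cmod z \<le> R" | "cmod z \<ge> R" by linarith
    then show ?thesis
    proof cases
      case 1
      have "(1 / (t + F z)) ^ ?q \<le> (1 / t) ^ ?q"
        using t nonneg[of z] by (intro power_mono divide_left_mono mult_pos_pos) auto
      then have "ennreal ((1 / (t + F z)) ^ ?q) \<le> indicator (cball 0 \<sigma>) z * ennreal ((1 / t) ^ ?q)"
        using 1 by (simp add: ennreal_leI)
      then show ?thesis by (simp add: add_increasing2)
    next
      case 2
      have "(1 / (t + F z)) ^ ?q \<le> (1 / sqrt t) ^ ?q"
        using t big[OF 2(1)] nonneg[of z]
        by (intro power_mono divide_left_mono mult_pos_pos) (auto simp: add_pos_nonneg)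
      also have "\<dots> = ((1 / sqrt t)\<^sup>2) ^ (m + 1)"
        by (simp only: power_mult[symmetric]) simp
      also have "(1 / sqrt t)\<^sup>2 = 1 / t" using t by (simp add: power_divide)
      finally have "ennreal ((1 / (t + F z)) ^ ?q) \<le> indicator (cball 0 R) z * ennreal ((1 / t) ^ (m + 1))"
        using 2 by (simp add: ennreal_leI)
      then show ?thesis by (simp add: add_increasing2 add_increasing)
    next
      case 3
      have z1: "cmod z \<ge> 1" using 3 R by simp
      have F: "C * cmod z powr \<eta> \<le> t + F z" using growth[OF 3] t by simp
      have "cmod z \<noteq> 0" using z1 by linarith
      then have zpos: "cmod z powr \<eta> > 0" by (simp only: powr_gt_zero) simp
      with C have pos: "C * cmod z powr \<eta> > 0" by (rule mult_pos_pos)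
      have "(1 / (t + F z)) ^ ?q \<le> (1 / (C * cmod z powr \<eta>)) ^ ?q"
        by (intro power_mono frac_le F pos) (use t nonneg[of z] in auto)
      also have "\<dots> = (1 / C) ^ ?q * (1 / (cmod z powr \<eta>) ^ ?q)"
        by (simp add: power_divide power_mult_distrib del: power_Suc)
      also have "(cmod z powr \<eta>) ^ ?q = cmod z powr (\<eta> * real ?q)"
        using zpos by (simp only: powr_realpow[symmetric] powr_powr)
      also have "(1 / C) ^ ?q * (1 / cmod z powr (\<eta> * real ?q)) \<le> (1 / C) ^ ?q * (1 / cmod z ^ 4)"
      proof (intro mult_left_mono divide_left_mono mult_pos_pos)
        have "cmod z ^ 4 = cmod z powr 4" using z1 powr_realpow[of "cmod z" 4] by simp
        also have "\<dots> \<le> cmod z powr (\<eta> * real ?q)" using m z1 by (intro powr_mono) auto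
        finally show "cmod z ^ 4 \<le> cmod z powr (\<eta> * real ?q)" .
      qed (use z1 C in auto)
      finally have "ennreal ((1 / (t + F z)) ^ ?q)
          \<le> ennreal ((1 / C) ^ ?q) * (indicator {u. R \<le> cmod u} z * ennreal (1 / cmod z ^ 4))"
        using 3 C by (simp add: ennreal_leI ennreal_mult'[symmetric] del: power_Suc)
      then show ?thesis by (simp add: add_increasing)
    qed
  qed
  have "(\<integral>\<^sup>+z. ennreal ((1 / (t + F z)) ^ ?q) \<partial>lborel) \<le> (\<integral>\<^sup>+z. ?g z \<partial>lborel)"
    by (intro nn_integral_mono pt)
  also have "\<dots> = ennreal (pi * \<sigma>\<^sup>2) * ennreal ((1 / t) ^ ?q) + ennreal (pi * R\<^sup>2) * ennreal ((1 / t) ^ (m + 1))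
      + ennreal ((1 / C) ^ ?q) * (\<integral>\<^sup>+z. indicator {u. R \<le> cmod u} z * ennreal (1 / cmod z ^ 4) \<partial>lborel)"
  proof -
    have mb: "(\<lambda>z. indicator (cball (0::complex) r) z * c) \<in> borel_measurable lborel"
      for r and c :: ennreal
      by (intro borel_measurable_times_ennreal borel_measurable_indicator borel_measurable_const) simp
    have mt: "(\<lambda>z::complex. ennreal ((1 / C) ^ ?q) * (indicator {u. R \<le> cmod u} z * ennreal (1 / cmod z ^ 4)))
        \<in> borel_measurable lborel" by measurable
    have "(\<integral>\<^sup>+z. ?g z \<partial>lborel)
        = (\<integral>\<^sup>+z. indicator (cball (0::complex) \<sigma>) z * ennreal ((1 / t) ^ ?q)
            + indicator (cball 0 R) z * ennreal ((1 / t) ^ (m + 1)) \<partial>lborel)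
          + (\<integral>\<^sup>+z. ennreal ((1 / C) ^ ?q) * (indicator {u. R \<le> cmod u} z * ennreal (1 / cmod z ^ 4)) \<partial>lborel)"
      by (rule nn_integral_add; intro borel_measurable_add mb mt)
    also have "(\<integral>\<^sup>+z. indicator (cball (0::complex) \<sigma>) z * ennreal ((1 / t) ^ ?q)
            + indicator (cball 0 R) z * ennreal ((1 / t) ^ (m + 1)) \<partial>lborel)
        = (\<integral>\<^sup>+z. indicator (cball (0::complex) \<sigma>) z * ennreal ((1 / t) ^ ?q) \<partial>lborel)
          + (\<integral>\<^sup>+z. indicator (cball (0::complex) R) z * ennreal ((1 / t) ^ (m + 1)) \<partial>lborel)"
      by (rule nn_integral_add; intro mb)
    also have "(\<integral>\<^sup>+z. ennreal ((1 / C) ^ ?q) * (indicator {u. R \<le> cmod u} z * ennreal (1 / cmod z ^ 4)) \<partial>lborel)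
        = ennreal ((1 / C) ^ ?q) * (\<integral>\<^sup>+z. indicator {u. R \<le> cmod u} z * ennreal (1 / cmod z ^ 4) \<partial>lborel)"
      by (rule nn_integral_cmult) measurable
    finally show ?thesis using \<sigma> R by (simp only: nn_integral_cball_const less_imp_le order_trans[OF zero_le_one])
  qed
  also have "\<dots> \<le> ennreal (pi * \<sigma>\<^sup>2) * ennreal ((1 / t) ^ ?q) + ennreal (pi * R\<^sup>2) * ennreal ((1 / t) ^ (m + 1))
      + ennreal ((1 / C) ^ ?q) * ennreal (16 * pi / (3 * R\<^sup>2))"
    using R by (intro add_left_mono mult_left_mono nn_integral_inverse_fourth_tail) auto
  also have "\<dots> = ennreal (pi * \<sigma>\<^sup>2 * (1 / t) ^ ?q + pi * R\<^sup>2 * (1 / t) ^ (m + 1)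
      + (1 / C) ^ ?q * (16 * pi / (3 * R\<^sup>2)))"
    using t C by (simp add: ennreal_mult'[symmetric] ennreal_plus[symmetric] del: power_Suc ennreal_plus)
  also have "\<dots> \<le> ennreal ((pi * \<sigma>\<^sup>2 + t * (pi * R\<^sup>2 + 16 * pi / 3 * (1 / C) ^ ?q)) / t ^ ?q)"
  proof (rule ennreal_leI)
    have "(1 / t) ^ (m + 1) \<le> t / t ^ ?q"
    proof -
      have "t ^ ?q = t ^ (m + 1) * t ^ (m + 1)" by (simp add: power_add[symmetric] mult_2)
      moreover have "t ^ (m + 1) \<le> t" using t power_decreasing[of 1 "m + 1" t] by simp
      ultimately show ?thesis using t by (simp add: field_simps)
    qed
    then have 1: "pi * R\<^sup>2 * (1 / t) ^ (m + 1) \<le> pi * R\<^sup>2 * (t / t ^ ?q)"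
      by (intro mult_left_mono) auto
    have "t ^ ?q \<le> t" using t power_decreasing[of 1 ?q t] by simp
    then have "1 \<le> t / t ^ ?q" using t by (simp add: field_simps)
    then have "16 * pi / 3 * 1 \<le> 16 * pi / 3 * (t / t ^ ?q)" by (intro mult_left_mono) auto
    moreover have "16 * pi / (3 * R\<^sup>2) \<le> 16 * pi / 3 * 1"
      using R by (simp add: field_simps)
    ultimately have "16 * pi / (3 * R\<^sup>2) \<le> 16 * pi / 3 * (t / t ^ ?q)" by linarith
    then have 2: "(1 / C) ^ ?q * (16 * pi / (3 * R\<^sup>2)) \<le> (1 / C) ^ ?q * (16 * pi / 3 * (t / t ^ ?q))"
      using C by (intro mult_left_mono) auto
    have "(pi * \<sigma>\<^sup>2 + t * (pi * R\<^sup>2 + 16 * pi / 3 * (1 / C) ^ ?q)) / t ^ ?q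
        = pi * \<sigma>\<^sup>2 * (1 / t) ^ ?q + pi * R\<^sup>2 * (t / t ^ ?q) + (1 / C) ^ ?q * (16 * pi / 3 * (t / t ^ ?q))"
      by (simp add: add_divide_distrib power_one_over distrib_left mult_ac del: power_Suc)
    then show "pi * \<sigma>\<^sup>2 * (1 / t) ^ ?q + pi * R\<^sup>2 * (1 / t) ^ (m + 1) + (1 / C) ^ ?q * (16 * pi / (3 * R\<^sup>2))
        \<le> (pi * \<sigma>\<^sup>2 + t * (pi * R\<^sup>2 + 16 * pi / 3 * (1 / C) ^ ?q)) / t ^ ?q"
      using 1 2 by linarith
  qed
  finally show ?thesis .
qed

section \<open>The growth of the kernel near a boundary point of infinite type\<close>

theorem theorem1p2:
  fixes F :: "complex \<Rightarrow> real" and f :: "real \<Rightarrow> real"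
  assumes "smooth F"
    and "subharmonic F"
    and "vanishes_to_infinite_order F 0"
    and "\<And>z. F z = F (of_real (cmod z))"
    and "\<exists>\<eta>>0. \<exists>R>0. \<exists>C>0. \<forall>z. cmod z \<ge> R \<longrightarrow> F z \<ge> C * cmod z powr \<eta>"
    and "\<not> levi_flat_around (graph_domain F) (graph_defining F) (0, 0)"
    and "\<And>z. f (cmod z) = F z"
  shows "strict_mono_on {0..} f \<and>
    (Lambda_condition f \<longrightarrow>
      (\<exists>C\<^sub>0>0. \<exists>C\<^sub>1>0.
        (\<forall>\<alpha>>0. \<forall>N::nat. N > 0 \<longrightarrow>
          (\<exists>H>0. \<forall>z w. (z, w) \<in> approach_region F \<alpha> N \<and> 0 < Im w \<and> Im w < H \<longrightarrow>
             C\<^sub>0 * Im w powi (-2) * profile_inv f (Im w) powi (-2) \<le> diag_kernel F z w \<and>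
             diag_kernel F z w \<le> C\<^sub>1 * Im w powi (-2) * profile_inv f (Im w) powi (-2))) \<and>
        (\<exists>H\<^sub>0>0. \<forall>z w. (z, w) \<in> graph_domain F \<and> Im w < H\<^sub>0 \<longrightarrow>
             C\<^sub>0 * Im w powi (-2) * profile_inv f (Im w) powi (-2) \<le> diag_kernel F z w)))"
proof -
  have contF: "continuous_on UNIV F" by (rule smooth_continuous_on[OF assms(1)])
  have F0: "F 0 = 0"
    using assms(3)[unfolded vanishes_to_infinite_order_def, rule_format, of "[]"] by simp
  have mono: "strict_mono_on {0..} f"
  proof (rule radial_subharmonic_strict_mono[OF assms(2) contF assms(7)])
    fix r :: real assume "r > 0"
    then show "\<exists>z. cmod z < r \<and> F z \<noteq> F 0"
      using levi_flat_around_of_locally_zero[of r F] assms(6) F0 by metis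
  qed
  have f_real: "f x = F (of_real x)" if "x \<ge> 0" for x
    using assms(7)[of "of_real x"] that by simp
  have f0: "f 0 = 0" using f_real[of 0] F0 by simp
  have less_iff: "f x < f y \<longleftrightarrow> x < y" if "x \<ge> 0" "y \<ge> 0" for x y
    using strict_mono_on_less[OF mono, of x y] that by simp
  have le_iff: "f x \<le> f y \<longleftrightarrow> x \<le> y" if "x \<ge> 0" "y \<ge> 0" for x y
    using less_iff[OF that(2,1)] by (simp add: linorder_not_less[symmetric])
  have nonneg: "F z \<ge> 0" for z
    using le_iff[of 0 "cmod z"] f0 assms(7)[of z] by simp
  obtain \<eta> R' C where \<eta>: "\<eta> > 0" and R': "R' > 0" and C: "C > 0"
    and growth: "\<And>z. cmod z \<ge> R' \<Longrightarrow> F z \<ge> C * cmod z powr \<eta>"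
    using assms(5) by blast
  define R where "R = max R' 1"
  have R: "R \<ge> 1" "\<And>z. cmod z \<ge> R \<Longrightarrow> F z \<ge> C * cmod z powr \<eta>"
    using growth by (auto simp: R_def)
  have surj: "f ` {0..} = {0..}"
  proof
    show "f ` {0..} \<subseteq> {0..}" using le_iff[of 0] f0 by fastforce
    show "{0..} \<subseteq> f ` {0..}"
    proof
      fix y :: real assume y: "y \<in> {0..}"
      define x where "x = max R ((y / C) powr (1 / \<eta>))"
      have x: "x \<ge> R" "x > 0" using R(1) by (auto simp: x_def)
      have "y / C = ((y / C) powr (1 / \<eta>)) powr \<eta>"
        using y C \<eta> by (simp add: powr_powr)
      also have "\<dots> \<le> x powr \<eta>" using \<eta> by (intro powr_mono2) (auto simp: x_def)
      finally have "y \<le> C * x powr \<eta>" using C by (simp add: field_simps)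
      also have "\<dots> \<le> f x" using R(2)[of "of_real x"] x f_real[of x] by simp
      finally have "y \<le> f x" .
      moreover have "continuous_on {0..x} f"
      proof -
        have "continuous_on {0..x} (\<lambda>x. F (of_real x))"
          by (rule continuous_on_compose2[OF contF]) (auto intro!: continuous_intros)
        then show ?thesis by (rule continuous_on_eq) (auto simp: f_real)
      qed
      ultimately show "y \<in> f ` {0..}"
        using IVT'[of f 0 y x] y x f0 by force
    qed
  qed
  note inv = profile_inv[OF surj]
  have flat: "\<exists>D>0. \<forall>x\<in>{0..1}. f x \<le> D * x ^ n" for n
    using flat_order_bound[OF assms(1,3), of 1 n] by (simp add: f_real scaleR_conv_of_real)
  have main: "\<exists>C\<^sub>0>0. \<exists>C\<^sub>1>0.
        (\<forall>\<alpha>>0. \<forall>N::nat. N > 0 \<longrightarrow>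
          (\<exists>H>0. \<forall>z w. (z, w) \<in> approach_region F \<alpha> N \<and> 0 < Im w \<and> Im w < H \<longrightarrow>
             C\<^sub>0 * Im w powi (-2) * profile_inv f (Im w) powi (-2) \<le> diag_kernel F z w \<and>
             diag_kernel F z w \<le> C\<^sub>1 * Im w powi (-2) * profile_inv f (Im w) powi (-2))) \<and>
        (\<exists>H\<^sub>0>0. \<forall>z w. (z, w) \<in> graph_domain F \<and> Im w < H\<^sub>0 \<longrightarrow>
             C\<^sub>0 * Im w powi (-2) * profile_inv f (Im w) powi (-2) \<le> diag_kernel F z w)"
    if cond: "Lambda_condition f"
  proof -
    \<comment> \<open>the profile falls at least to its square when its argument shrinks by the factor \<open>l\<close>; so with
       \<open>s = profile_inv f t\<close> one has \<open>f (l * s) \<ge> sqrt t\<close> and \<open>f (s / l) \<le> t\<^sup>2\<close>\<close>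
    obtain l e where l: "l > 1" and e: "e > 0" and sq: "\<And>x. 0 < x \<Longrightarrow> x < e \<Longrightarrow> f x \<le> (f (l * x))\<^sup>2"
      using Lambda_condition_square_growth[OF mono surj f0 cond] by blast
    obtain D where D: "D > 0" "\<And>x. x \<in> {0..1} \<Longrightarrow> f x \<le> D * x ^ 2" using flat[of 2] by blast
    \<comment> \<open>large enough that \<open>F\<close> to the power \<open>2 * m + 2\<close> grows at least like \<open>|z|\<^sup>4\<close>\<close>
    obtain m :: nat where m: "4 / \<eta> \<le> real (2 * m + 2)"
    proof -
      obtain m :: nat where "4 / \<eta> \<le> real m" using real_arch_simple by blast
      then show thesis using that[of m] by simp
    qed
    then have m4: "\<eta> * real (2 * m + 2) \<ge> 4" using \<eta> by (simp add: field_simps)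
    define H\<^sub>0 where "H\<^sub>0 = Min {f e, f 1, 1/2}"
    have H\<^sub>0: "H\<^sub>0 > 0" using less_iff[of 0 e] less_iff[of 0 1] e f0 by (simp add: H\<^sub>0_def)
    have s: "0 < profile_inv f t" "f (profile_inv f t) = t" "profile_inv f t < e" "profile_inv f t < 1"
      if "0 < t" "t < H\<^sub>0" for t
    proof -
      let ?s = "profile_inv f t"
      have s0: "?s \<ge> 0" and fs: "f ?s = t" using inv[of t] that by auto
      show "f ?s = t" by fact
      show "0 < ?s" using less_iff[of 0 ?s] s0 fs f0 that by simp
      show "?s < e" using less_iff[of ?s e] s0 fs e that by (simp add: H\<^sub>0_def)
      show "?s < 1" using less_iff[of ?s 1] s0 fs that by (simp add: H\<^sub>0_def)
    qed
    define M where "M = pi * R\<^sup>2 + 16 * pi / 3 * (1 / C) ^ (2 * m + 2)"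
    have M: "M \<ge> 0" using C by (auto simp: M_def intro!: add_nonneg_nonneg)
    define K where "K = pi * l\<^sup>2 + D * M"
    have K: "K > 0" using l D M by (auto simp: K_def intro!: add_pos_nonneg)
    define C\<^sub>0 where "C\<^sub>0 = 1 / (2 ^ (2 * m + 4) * (16 * pi / 3 * K))"
    have C\<^sub>0: "C\<^sub>0 > 0" using K by (simp add: C\<^sub>0_def)
    have powi: "c * t powi (-2) * s powi (-2) = c / (t\<^sup>2 * s\<^sup>2)" for c t s :: real
      by (simp add: power_int_def divide_inverse power_inverse inverse_mult_distrib mult.assoc)
    have lower: "C\<^sub>0 * Im w powi (-2) * profile_inv f (Im w) powi (-2) \<le> diag_kernel F z w"
      if zw: "(z, w) \<in> graph_domain F" and "Im w < H\<^sub>0" for z w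
    proof -
      define t where "t = Im w"
      define s where "s = profile_inv f t"
      have t: "0 < t" "t < H\<^sub>0"
        using zw nonneg[of z] that(2) by (auto simp: graph_domain_def t_def)
      then have t1: "t \<le> 1" by (simp add: H\<^sub>0_def)
      have s0: "0 < s" "f s = t" "s < e" "s < 1" using s[OF t] by (auto simp: s_def)
      have big: "sqrt t \<le> F v" if "cmod v > l * s" for v
      proof -
        have "sqrt t \<le> sqrt ((f (l * s))\<^sup>2)"
          using sq[OF s0(1,3)] unfolding s0(2) by (rule real_sqrt_le_mono)
        also have "\<dots> = f (l * s)" using le_iff[of 0 "l * s"] f0 l s0 by simp
        also have "\<dots> \<le> f (cmod v)" using that l s0 by (subst le_iff) auto
        finally show ?thesis by (simp add: assms(7))
      qed
      have "(\<integral>\<^sup>+v. ennreal ((1 / (t + F v)) ^ (2 * m + 2)) \<partial>lborel)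
          \<le> ennreal ((pi * (l * s)\<^sup>2 + t * M) / t ^ (2 * m + 2))"
        unfolding M_def
        by (rule radial_weight_integral[OF contF nonneg t(1) t1 _ big R(1) C R(2) m4]) (use l s0 in auto)
      also have "\<dots> \<le> ennreal (K * s\<^sup>2 / t ^ (2 * m + 2))"
      proof (intro ennreal_leI divide_right_mono)
        have "t \<le> D * s\<^sup>2" using D(2)[of s] s0 by simp
        then have "t * M \<le> D * s\<^sup>2 * M" using M by (intro mult_right_mono) auto
        then show "pi * (l * s)\<^sup>2 + t * M \<le> K * s\<^sup>2"
          by (simp add: K_def power_mult_distrib algebra_simps)
      qed (use t in simp)
      finally have W: "(\<integral>\<^sup>+v. ennreal ((1 / (Im w + F v)) ^ (2 * m + 2)) \<partial>lborel)
          \<le> ennreal (K * s\<^sup>2 / t ^ (2 * m + 2))" by (simp only: t_def)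
      have "(1 / (2 * Im w)) ^ (2 * m + 4) / (16 * pi / 3 * (K * s\<^sup>2 / t ^ (2 * m + 2))) \<le> diag_kernel F z w"
        by (rule diag_kernel_lower_of_weight[OF contF nonneg zw W]) (use K s0 t in simp)
      moreover have "(1 / (2 * Im w)) ^ (2 * m + 4) / (16 * pi / 3 * (K * s\<^sup>2 / t ^ (2 * m + 2)))
          = C\<^sub>0 / (t\<^sup>2 * s\<^sup>2)"
      proof -
        have "2 * m + 4 = (2 * m + 2) + 2" by simp
        then have "t ^ (2 * m + 4) = t ^ (2 * m + 2) * t\<^sup>2" by (simp only: power_add[of t "2 * m + 2" 2])
        then show ?thesis
          using t s0 K by (simp add: C\<^sub>0_def t_def[symmetric] power_one_over power_mult_distrib
              divide_simps del: power_Suc)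
      qed
      ultimately show ?thesis by (simp add: powi t_def s_def)
    qed
    define C\<^sub>1 where "C\<^sub>1 = 16 * l\<^sup>2 / pi\<^sup>2"
    have C\<^sub>1: "C\<^sub>1 > 0" using l by (simp add: C\<^sub>1_def)
    have upper: "\<exists>H>0. H \<le> H\<^sub>0 \<and> (\<forall>z w. (z, w) \<in> approach_region F \<alpha> N \<and> 0 < Im w \<and> Im w < H \<longrightarrow>
        diag_kernel F z w \<le> C\<^sub>1 * Im w powi (-2) * profile_inv f (Im w) powi (-2))"
      if \<alpha>: "\<alpha> > 0" and N: "N > 0" for \<alpha> :: real and N :: nat
    proof -
      obtain E where E: "E > 0" "\<And>x. x \<in> {0..1} \<Longrightarrow> f x \<le> E * x ^ (N + 1)" using flat[of "N + 1"] by blast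
      \<comment> \<open>for \<open>s < \<delta>\<close> flatness of order \<open>N + 1\<close> puts the approach region into the disc of radius \<open>s / (2 * l)\<close>\<close>
      define \<delta> where "\<delta> = 1 / (E * (2 * l * \<alpha>) ^ N)"
      have \<delta>: "\<delta> > 0" using E l \<alpha> by (simp add: \<delta>_def)
      define H where "H = min H\<^sub>0 (f \<delta>)"
      have "H > 0" using H\<^sub>0 less_iff[of 0 \<delta>] \<delta> f0 by (simp add: H_def)
      moreover have "H \<le> H\<^sub>0" by (simp add: H_def)
      moreover have "diag_kernel F z w \<le> C\<^sub>1 * Im w powi (-2) * profile_inv f (Im w) powi (-2)"
        if zw: "(z, w) \<in> approach_region F \<alpha> N" "0 < Im w" "Im w < H" for z w
      proof -
        define t where "t = Im w"
        define s where "s = profile_inv f t"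
        have t: "0 < t" "t < H\<^sub>0" using zw by (auto simp: t_def H_def)
        have s0: "0 < s" "f s = t" "s < e" "s < 1" using s[OF t] by (auto simp: s_def)
        have "s < \<delta>" using less_iff[of s \<delta>] s0 \<delta> zw(3) by (simp add: H_def t_def)
        then have "E * s * (2 * l * \<alpha>) ^ N \<le> 1" using E l \<alpha> by (simp add: \<delta>_def field_simps)
        then have "E * s * (2 * l * \<alpha>) ^ N * s ^ N \<le> 1 * s ^ N" using s0 by (intro mult_right_mono) auto
        then have "E * s ^ (N + 1) \<le> (s / (2 * l * \<alpha>)) ^ N"
          using l \<alpha> by (simp add: power_divide field_simps)
        then have tN: "t \<le> (s / (2 * l * \<alpha>)) ^ N" using E(2)[of s] s0 by simp
        have pos: "s / (2 * l * \<alpha>) > 0" using s0 l \<alpha> by simp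
        have "t powr (1 / real N) \<le> ((s / (2 * l * \<alpha>)) ^ N) powr (1 / real N)"
          using tN t by (intro powr_mono2) auto
        also have "\<dots> = s / (2 * l * \<alpha>)"
        proof -
          have "(X ^ N) powr (1 / real N) = X" if "X > 0" for X :: real
            using that N by (simp add: powr_realpow[symmetric] powr_powr)
          from this[OF pos] show ?thesis .
        qed
        finally have "\<alpha> * t powr (1 / real N) \<le> s / (2 * l)"
          using \<alpha> l by (simp add: field_simps)
        moreover have "cmod z \<le> sqrt ((cmod z)\<^sup>2 + (Re w)\<^sup>2)"
          by (rule real_le_rsqrt) simp
        moreover have "sqrt ((cmod z)\<^sup>2 + (Re w)\<^sup>2) < \<alpha> * t powr (1 / real N)"
          using zw(1) by (simp add: approach_region_def t_def)
        ultimately have z: "cmod z \<le> s / (2 * l)" by linarith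
        have small: "F v < t / 2" if "cmod v \<le> 2 * (s / (2 * l))" for v
        proof -
          have "f (cmod v) \<le> f (s / l)" using that s0 l by (subst le_iff) auto
          also have "\<dots> \<le> (f (l * (s / l)))\<^sup>2"
            using s0 l by (intro sq) (auto simp: field_simps intro: less_le_trans[of s e])
          also have "\<dots> = t * t" using l s0 by (simp add: power2_eq_square)
          also have "\<dots> < t * (1 / 2)" using t by (intro mult_strict_left_mono) (auto simp: H\<^sub>0_def)
          finally show ?thesis by (simp add: assms(7))
        qed
        have "diag_kernel F z w \<le> 4 / (pi\<^sup>2 * (s / (2 * l))\<^sup>2 * t\<^sup>2)"
          by (rule diag_kernel_upper_of_polydisc[OF contF _ t(1) small z]) (use s0 l in \<open>auto simp: t_def\<close>)
        also have "\<dots> = C\<^sub>1 / (t\<^sup>2 * s\<^sup>2)"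
          using l s0 t by (simp add: C\<^sub>1_def field_simps power2_eq_square)
        finally show ?thesis by (simp add: powi t_def s_def)
      qed
      ultimately show ?thesis by blast
    qed
    have two_sided: "\<exists>H>0. \<forall>z w. (z, w) \<in> approach_region F \<alpha> N \<and> 0 < Im w \<and> Im w < H \<longrightarrow>
             C\<^sub>0 * Im w powi (-2) * profile_inv f (Im w) powi (-2) \<le> diag_kernel F z w \<and>
             diag_kernel F z w \<le> C\<^sub>1 * Im w powi (-2) * profile_inv f (Im w) powi (-2)"
      if \<alpha>: "\<alpha> > 0" and N: "N > 0" for \<alpha> :: real and N :: nat
    proof -
      obtain H where H: "H > 0" "H \<le> H\<^sub>0"
        "\<forall>z w. (z, w) \<in> approach_region F \<alpha> N \<and> 0 < Im w \<and> Im w < H \<longrightarrow>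
           diag_kernel F z w \<le> C\<^sub>1 * Im w powi (-2) * profile_inv f (Im w) powi (-2)"
        using upper[OF \<alpha> N] by blast
      show ?thesis
      proof (intro exI[of _ H] conjI allI impI)
        fix z w assume *: "(z, w) \<in> approach_region F \<alpha> N \<and> 0 < Im w \<and> Im w < H"
        then have "(z, w) \<in> graph_domain F" "Im w < H\<^sub>0" using H(2) by (auto simp: approach_region_def)
        then show "C\<^sub>0 * Im w powi (-2) * profile_inv f (Im w) powi (-2) \<le> diag_kernel F z w" by (rule lower)
        show "diag_kernel F z w \<le> C\<^sub>1 * Im w powi (-2) * profile_inv f (Im w) powi (-2)"
          using H(3) * by blast
      qed (rule H(1))
    qed
    have lower_all: "\<exists>H\<^sub>0>0. \<forall>z w. (z, w) \<in> graph_domain F \<and> Im w < H\<^sub>0 \<longrightarrow>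
             C\<^sub>0 * Im w powi (-2) * profile_inv f (Im w) powi (-2) \<le> diag_kernel F z w"
      using lower H\<^sub>0 by (intro exI[of _ H\<^sub>0]) auto
    have two_sided_all: "\<forall>\<alpha>>0. \<forall>N::nat. N > 0 \<longrightarrow>
          (\<exists>H>0. \<forall>z w. (z, w) \<in> approach_region F \<alpha> N \<and> 0 < Im w \<and> Im w < H \<longrightarrow>
             C\<^sub>0 * Im w powi (-2) * profile_inv f (Im w) powi (-2) \<le> diag_kernel F z w \<and>
             diag_kernel F z w \<le> C\<^sub>1 * Im w powi (-2) * profile_inv f (Im w) powi (-2))"
      by (intro allI impI two_sided)
    show ?thesis
      by (rule exI[of _ C\<^sub>0], rule conjI[OF C\<^sub>0], rule exI[of _ C\<^sub>1], rule conjI[OF C\<^sub>1],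
          rule conjI[OF two_sided_all lower_all])
  qed
  show ?thesis using mono main by blast
qed

end
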